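(* $\mathsf{BID}\subseteq\mathsf{FO}(\mathsf{TI})$.
   Context: Fix a countably infinite universe $U$. A database schema is a finite nonempty set of relation symbols with arities; facts are $R(u_1,\dots,u_{\mathrm{ar}(R)})$ with $u_i\in U$; an instance is a finite set of facts; $\mathrm{adom}(D)$ is the set of elements of $U$ occurring in $D$. A probabilistic database (PDB) is a discrete probability space $(\mathbb D,P)$ with $\mathbb D$ a nonempty countable set of instances over a schema; $\mathrm{facts}(\mathcal D)$ is the union of all instances of positive probability. A PDB $\mathcal I$ is tuple-independent if for all pairwise distinct facts $f_1,\dots,f_k$, $\Pr_{I\sim\mathcal I}(f_1\in I,\dots,f_k\in I)=\prod_i\Pr_{I\sim\mathcal I}(f_i\in I)$; $\mathsf{TI}$ is the class of such PDBs. A PDB $\mathcal I$ is block-independent disjoint if there is a partition of $\mathrm{facts}(\mathcal I)$ into blocks such that (1) for facts $f_1,\dots,f_k$ from pairwise different blocks, $\Pr(f_1\in I,\dots,f_k\in I)=\prod_i\Pr(f_i\in I)$, and (2) for distinct facts $f,f'$ in the same block, $\Pr(f\in I\text{ and }f'\in I)=0$; $\mathsf{BID}$ is the class of such PDBs. An FO-view consists of one first-order formula $\Phi_R(x_1,\dots,x_{\mathrm{ar}(R)})$ per output relation symbol $R$, evaluated under active domain semantics (quantifiers range over $\mathrm{adom}(D)$ and the formula's constants), mapping $D$ to the instance containing $R(\bar a)$ for all tuples $\bar a$ over $\mathrm{adom}(D)\cup\mathrm{adom}(\Phi_R)$ with $D\models\Phi_R[\bar a]$. The image of a PDB $(\mathbb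 D,P)$ under a view $V$ is the PDB on $V(\mathbb D)$ with $P'(\{D'\})=P(\{D:V(D)=D'\})$. $\mathsf{FO}(\mathsf{TI})$ is the class of images of TI-PDBs under FO-views. *)

theory Defs
  imports "HOL-Probability.Probability" "HOL-Library.Disjoint_Sets"
begin

type_synonym ('r, 'u) fact = "'r \<times> 'u list"
type_synonym ('r, 'u) inst = "('r, 'u) fact set"

definition schema :: "'r set \<Rightarrow> bool" where
  "schema S \<longleftrightarrow> finite S \<and> S \<noteq> {}"

definition fact_over :: "'r set \<Rightarrow> ('r \<Rightarrow> nat) \<Rightarrow> ('r, 'u) fact \<Rightarrow> bool" where
  "fact_over S ar f \<longleftrightarrow> fst f \<in> S \<and> length (snd f) = ar (fst f)"

definition inst_over :: "'r set \<Rightarrow> ('r \<Rightarrow> nat) \<Rightarrow> ('r, 'u) inst \<Rightarrow> bool" where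
  "inst_over S ar D \<longleftrightarrow> finite D \<and> (\<forall>f\<in>D. fact_over S ar f)"

definition adom :: "('r, 'u) inst \<Rightarrow> 'u set" where
  "adom D = (\<Union>f\<in>D. set (snd f))"

text \<open>A PDB over a schema is represented by its (discrete) probability distribution on
  instances, a pmf; its support is countable and consists of instances over the schema.\<close>

definition pdb :: "'r set \<Rightarrow> ('r \<Rightarrow> nat) \<Rightarrow> ('r, 'u) inst pmf \<Rightarrow> bool" where
  "pdb S ar P \<longleftrightarrow> schema S \<and> (\<forall>D\<in>set_pmf P. inst_over S ar D)"

definition pdb_facts :: "('r, 'u) inst pmf \<Rightarrow> ('r, 'u) fact set" where
  "pdb_facts P = \<Union> (set_pmf P)"

definition is_TI :: "'r set \<Rightarrow> ('r \<Rightarrow> nat) \<Rightarrow> ('r, 'u) inst pmf \<Rightarrow> bool" where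
  "is_TI S ar P \<longleftrightarrow> pdb S ar P \<and>
     (\<forall>F. finite F \<longrightarrow>
        measure_pmf.prob P {D. F \<subseteq> D} = (\<Prod>f\<in>F. measure_pmf.prob P {D. f \<in> D}))"

definition is_BID :: "'r set \<Rightarrow> ('r \<Rightarrow> nat) \<Rightarrow> ('r, 'u) inst pmf \<Rightarrow> bool" where
  "is_BID S ar P \<longleftrightarrow> pdb S ar P \<and>
     (\<exists>B. partition_on (pdb_facts P) B \<and>
        (\<forall>F. finite F \<and> F \<subseteq> pdb_facts P \<and>
              (\<forall>f\<in>F. \<forall>g\<in>F. f \<noteq> g \<longrightarrow> \<not> (\<exists>b\<in>B. f \<in> b \<and> g \<in> b)) \<longrightarrow>
           measure_pmf.prob P {D. F \<subseteq> D} = (\<Prod>f\<in>F. measure_pmf.prob P {D. f \<in> D})) \<and>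
        (\<forall>b\<in>B. \<forall>f\<in>b. \<forall>g\<in>b. f \<noteq> g \<longrightarrow> measure_pmf.prob P {D. f \<in> D \<and> g \<in> D} = 0))"

datatype 'u fterm = Var nat | Const 'u

datatype ('r, 'u) fo =
    Atom 'r "'u fterm list"
  | Eq "'u fterm" "'u fterm"
  | Neg "('r, 'u) fo"
  | Conj "('r, 'u) fo" "('r, 'u) fo"
  | Disj "('r, 'u) fo" "('r, 'u) fo"
  | Ex nat "('r, 'u) fo"
  | All nat "('r, 'u) fo"

fun tval :: "(nat \<Rightarrow> 'u) \<Rightarrow> 'u fterm \<Rightarrow> 'u" where
  "tval \<sigma> (Var x) = \<sigma> x"
| "tval \<sigma> (Const c) = c"

fun tconsts :: "'u fterm \<Rightarrow> 'u set" where
  "tconsts (Var x) = {}"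
| "tconsts (Const c) = {c}"

fun tvars :: "'u fterm \<Rightarrow> nat set" where
  "tvars (Var x) = {x}"
| "tvars (Const c) = {}"

fun fo_consts :: "('r, 'u) fo \<Rightarrow> 'u set" where
  "fo_consts (Atom R ts) = (\<Union>t\<in>set ts. tconsts t)"
| "fo_consts (Eq t1 t2) = tconsts t1 \<union> tconsts t2"
| "fo_consts (Neg \<phi>) = fo_consts \<phi>"
| "fo_consts (Conj \<phi> \<psi>) = fo_consts \<phi> \<union> fo_consts \<psi>"
| "fo_consts (Disj \<phi> \<psi>) = fo_consts \<phi> \<union> fo_consts \<psi>"
| "fo_consts (Ex x \<phi>) = fo_consts \<phi>"
| "fo_consts (All x \<phi>) = fo_consts \<phi>"

fun fo_fv :: "('r, 'u) fo \<Rightarrow> nat set" where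
  "fo_fv (Atom R ts) = (\<Union>t\<in>set ts. tvars t)"
| "fo_fv (Eq t1 t2) = tvars t1 \<union> tvars t2"
| "fo_fv (Neg \<phi>) = fo_fv \<phi>"
| "fo_fv (Conj \<phi> \<psi>) = fo_fv \<phi> \<union> fo_fv \<psi>"
| "fo_fv (Disj \<phi> \<psi>) = fo_fv \<phi> \<union> fo_fv \<psi>"
| "fo_fv (Ex x \<phi>) = fo_fv \<phi> - {x}"
| "fo_fv (All x \<phi>) = fo_fv \<phi> - {x}"

fun fo_wf :: "'r set \<Rightarrow> ('r \<Rightarrow> nat) \<Rightarrow> ('r, 'u) fo \<Rightarrow> bool" where
  "fo_wf S ar (Atom R ts) \<longleftrightarrow> R \<in> S \<and> length ts = ar R"
| "fo_wf S ar (Eq t1 t2) \<longleftrightarrow> True"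
| "fo_wf S ar (Neg \<phi>) \<longleftrightarrow> fo_wf S ar \<phi>"
| "fo_wf S ar (Conj \<phi> \<psi>) \<longleftrightarrow> fo_wf S ar \<phi> \<and> fo_wf S ar \<psi>"
| "fo_wf S ar (Disj \<phi> \<psi>) \<longleftrightarrow> fo_wf S ar \<phi> \<and> fo_wf S ar \<psi>"
| "fo_wf S ar (Ex x \<phi>) \<longleftrightarrow> fo_wf S ar \<phi>"
| "fo_wf S ar (All x \<phi>) \<longleftrightarrow> fo_wf S ar \<phi>"

fun sat :: "('r, 'u) inst \<Rightarrow> 'u set \<Rightarrow> (nat \<Rightarrow> 'u) \<Rightarrow> ('r, 'u) fo \<Rightarrow> bool" where
  "sat D A \<sigma> (Atom R ts) \<longleftrightarrow> (R, map (tval \<sigma>) ts) \<in> D"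
| "sat D A \<sigma> (Eq t1 t2) \<longleftrightarrow> tval \<sigma> t1 = tval \<sigma> t2"
| "sat D A \<sigma> (Neg \<phi>) \<longleftrightarrow> \<not> sat D A \<sigma> \<phi>"
| "sat D A \<sigma> (Conj \<phi> \<psi>) \<longleftrightarrow> sat D A \<sigma> \<phi> \<and> sat D A \<sigma> \<psi>"
| "sat D A \<sigma> (Disj \<phi> \<psi>) \<longleftrightarrow> sat D A \<sigma> \<phi> \<or> sat D A \<sigma> \<psi>"
| "sat D A \<sigma> (Ex x \<phi>) \<longleftrightarrow> (\<exists>a\<in>A. sat D A (\<sigma>(x := a)) \<phi>)"
| "sat D A \<sigma> (All x \<phi>) \<longleftrightarrow> (\<forall>a\<in>A. sat D A (\<sigma>(x := a)) \<phi>)"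

text \<open>An FO-view from schema (S, ar) to schema (S', ar') assigns to each output symbol R in S'
  a formula over (S, ar) whose free variables are among x_0, ..., x_(ar' R - 1)
  (the paper's x_1, ..., x_ar(R)).\<close>

definition fo_view :: "'r set \<Rightarrow> ('r \<Rightarrow> nat) \<Rightarrow> 'r set \<Rightarrow> ('r \<Rightarrow> nat) \<Rightarrow> ('r \<Rightarrow> ('r, 'u) fo) \<Rightarrow> bool" where
  "fo_view S ar S' ar' V \<longleftrightarrow> schema S \<and> schema S' \<and>
     (\<forall>R\<in>S'. fo_wf S ar (V R) \<and> fo_fv (V R) \<subseteq> {..<ar' R})"

definition apply_view :: "'r set \<Rightarrow> ('r \<Rightarrow> nat) \<Rightarrow> ('r \<Rightarrow> ('r, 'u) fo) \<Rightarrow> ('r, 'u) inst \<Rightarrow> ('r, 'u) inst" where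
  "apply_view S' ar' V D =
     {(R, as). R \<in> S' \<and> length as = ar' R \<and> set as \<subseteq> adom D \<union> fo_consts (V R) \<and>
               sat D (adom D \<union> fo_consts (V R)) (\<lambda>i. as ! i) (V R)}"

definition in_FO_TI :: "'r set \<Rightarrow> ('r \<Rightarrow> nat) \<Rightarrow> ('r, 'u) inst pmf \<Rightarrow> bool" where
  "in_FO_TI S' ar' P \<longleftrightarrow>
     (\<exists>S ar Q V. is_TI S ar Q \<and> fo_view S ar S' ar' V \<and> map_pmf (apply_view S' ar' V) Q = P)"

end

theory Submission
  imports Defs
begin

text \<open>Apart from finitely many facts, the heads, the facts have total probability at most
  \<open>1/4\<close>, because the expected instance size of a BID-PDB is finite. Each block thus splits into its tail, of total
  probability \<open>q \<le> 1/4\<close>, and finitely many singleton cells, one per head, ordered by a rank.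
  The TI-PDB extends every fact by an identifier of its cell and adds, for each tail cell, one blocker
  fact. A cell is active if exactly one of its facts and not its blocker is present; the view outputs
  the fact of the first active cell of each block. It needs only finitely many constants since only the
  heads have predecessors. A tail fact of probability \<open>p\<close> gets odds \<open>p / (1 - 2 q)\<close>, and the
  blocker lowers the probability that the cell is empty to the required factor
  \<open>1 - 2 q\<close>; a head gets its probability conditioned on the absence of its predecessors. Unlike
  a linear order on the whole block, this keeps the total probability of the TI-facts finite even if
  a block with infinitely many facts is never empty.\<close>

section \<open>Distributions on finite sets\<close>

text \<open>The constants \<open>1 - 2 q\<close> and \<open>1 / 4\<close> come from one requirement.
  In a tail cell, the odds of \<open>f\<close> times the probability \<open>c\<close> that the whole
  cell is empty must equal \<open>p f\<close>, for all facts of the cell at once; so the odds are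
  \<open>p f / c\<close>. Without a blocker, \<open>c\<close> would have to solve the fixed-point
  equation \<open>c = \<Prod> 1 / (1 + p f / c)\<close>. The blocker relaxes this to an inequality:
  any positive \<open>c\<close> will do that does not exceed the probability that the facts alone
  are absent. The union bound shows the latter to be at least \<open>1 - q / c\<close>, and for
  \<open>c = 1 - 2 q\<close> this is at least \<open>c\<close> whenever
  \<open>q \<le> 1 / 4\<close>. Moreover \<open>c \<ge> 1 / 2\<close>, so tail marginals at most
  double and blockers have probability at most \<open>2 q\<close>; everything stays summable. A view
  cannot compute an order on identifiers, so the order is written out in constants. An infinite tail
  shares one identifier and counts as a single predecessor there.\<close>

definition finite_sets_pmf :: "'a set pmf \<Rightarrow> bool" where
  "finite_sets_pmf P \<longleftrightarrow> (\<forall>D\<in>set_pmf P. finite D)"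

lemma prob_pmf_cong:
  assumes "\<And>D. D \<in> set_pmf P \<Longrightarrow> D \<in> A \<longleftrightarrow> D \<in> B"
  shows "measure_pmf.prob P A = measure_pmf.prob P B"
  by (rule measure_pmf.finite_measure_eq_AE) (auto simp: AE_measure_pmf_iff assms)

lemma prob_pmf_mono:
  assumes "\<And>D. D \<in> set_pmf P \<Longrightarrow> D \<in> A \<Longrightarrow> D \<in> B"
  shows "measure_pmf.prob P A \<le> measure_pmf.prob P B"
  by (rule measure_pmf.finite_measure_mono_AE) (auto simp: AE_measure_pmf_iff assms)

lemma prob_pmf_Diff:
  "measure_pmf.prob P {D. Q D \<and> \<not> R D} = measure_pmf.prob P {D. Q D} - measure_pmf.prob P {D. Q D \<and> R D}"
  by (subst measure_pmf.finite_measure_Diff[symmetric]) (auto intro!: arg_cong[where f="measure_pmf.prob P"])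

lemma prob_pmf_Un_le:
  "measure_pmf.prob P {D. Q D \<or> R D} \<le> measure_pmf.prob P {D. Q D} + measure_pmf.prob P {D. R D}"
  using measure_Un_le[of "{D. Q D}" "measure_pmf P" "{D. R D}"] by (simp add: Collect_disj_eq)

lemma finite_sets_pmf_countable:
  assumes "finite_sets_pmf P"
  shows "countable (\<Union> (set_pmf P))"
proof -
  have "countable (\<Union>D\<in>set_pmf P. D)"
    using assms by (intro countable_UN) (auto simp: finite_sets_pmf_def intro: countable_finite)
  then show ?thesis by simp
qed

text \<open>Along an enumeration of the countable union of the support, the events of lying within
  the first \<open>n\<close> elements increase to a sure event, because every instance of the
  support is finite. This reduces infinite sets of facts to finite ones below.\<close>

lemma finite_sets_pmf_tight:
  assumes "finite_sets_pmf P" and "\<epsilon> > 0"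
  shows "\<exists>A. finite A \<and> A \<subseteq> \<Union> (set_pmf P) \<and> measure_pmf.prob P {D. \<not> D \<subseteq> A} < \<epsilon>"
proof -
  let ?G = "\<Union> (set_pmf P)"
  have cG: "countable ?G" using assms(1) by (rule finite_sets_pmf_countable)
  define A where "A n = {a\<in>?G. to_nat_on ?G a < n}" for n
  have finA: "finite (A n)" for n
  proof (rule finite_imageD)
    show "finite (to_nat_on ?G ` A n)"
      by (rule finite_subset[of _ "{..<n}"]) (auto simp: A_def)
    show "inj_on (to_nat_on ?G) (A n)"
      using inj_on_to_nat_on[OF cG] by (rule inj_on_subset) (auto simp: A_def)
  qed
  have inc: "incseq (\<lambda>n. {D. D \<subseteq> A n})"
    unfolding A_def by (intro monoI) fastforce
  have "D \<in> (\<Union>n. {D. D \<subseteq> A n})" if D: "D \<in> set_pmf P" for D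
  proof -
    have "finite D" using D assms(1) by (auto simp: finite_sets_pmf_def)
    then have "to_nat_on ?G a < Suc (Max (to_nat_on ?G ` D))" if "a \<in> D" for a
      using that by (simp add: less_Suc_eq_le)
    then have "D \<subseteq> A (Suc (Max (to_nat_on ?G ` D)))"
      using D by (auto simp: A_def)
    then show ?thesis by blast
  qed
  then have "measure_pmf.prob P (\<Union>n. {D. D \<subseteq> A n}) = 1"
    by (intro measure_pmf.prob_eq_1[THEN iffD2]) (auto simp: AE_measure_pmf_iff)
  then have "(\<lambda>n. measure_pmf.prob P {D. D \<subseteq> A n}) \<longlonglongrightarrow> 1"
    using measure_pmf.finite_Lim_measure_incseq[OF _ inc, of P] by simp
  then have "\<forall>\<^sub>F n in sequentially. measure_pmf.prob P {D. D \<subseteq> A n} > 1 - \<epsilon>"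
    by (rule order_tendstoD) (use assms in auto)
  then obtain n where n: "measure_pmf.prob P {D. D \<subseteq> A n} > 1 - \<epsilon>"
    using eventually_happens'[OF sequentially_bot] by blast
  have "measure_pmf.prob P {D. \<not> D \<subseteq> A n} = 1 - measure_pmf.prob P {D. D \<subseteq> A n}"
    using measure_pmf.prob_compl[of "{D. D \<subseteq> A n}" P] by (simp add: Collect_neg_eq Compl_eq_Diff_UNIV)
  with n finA[of n] show ?thesis
    by (intro exI[of _ "A n"]) (auto simp: A_def)
qed

text \<open>Inclusion-exclusion, one avoided element at a time: to avoid \<open>a\<close>, subtract
  the event in which \<open>a\<close> joins the required set. This is why \<open>F\<close> stays
  general.\<close>

lemma prob_superset_disjoint_eq:
  assumes eq: "\<And>F. finite F \<Longrightarrow> measure_pmf.prob P {D. F \<subseteq> D} = measure_pmf.prob Q {D. F \<subseteq> D}"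
    and "finite A" "finite F"
  shows "measure_pmf.prob P {D. F \<subseteq> D \<and> D \<inter> A = {}} = measure_pmf.prob Q {D. F \<subseteq> D \<and> D \<inter> A = {}}"
  using assms(2,3)
proof (induction A arbitrary: F)
  case empty
  then show ?case using eq by simp
next
  case (insert a A)
  have *: "measure_pmf.prob M {D. F \<subseteq> D \<and> D \<inter> insert a A = {}} =
      measure_pmf.prob M {D. F \<subseteq> D \<and> D \<inter> A = {}} - measure_pmf.prob M {D. insert a F \<subseteq> D \<and> D \<inter> A = {}}"
    for M :: "'a set pmf"
  proof -
    have "{D. F \<subseteq> D \<and> D \<inter> insert a A = {}} = {D. (F \<subseteq> D \<and> D \<inter> A = {}) \<and> \<not> a \<in> D}"
      "{D. insert a F \<subseteq> D \<and> D \<inter> A = {}} = {D. (F \<subseteq> D \<and> D \<inter> A = {}) \<and> a \<in> D}"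
      by auto
    then show ?thesis by (simp only: prob_pmf_Diff)
  qed
  show ?case unfolding * using insert.IH[of F] insert.IH[of "insert a F"] insert.prems by simp
qed

text \<open>Up to tightness, \<open>D0\<close> is the event that all of \<open>D0\<close> and
  nothing else from a large finite \<open>A\<close> is present. The one-sided bound is proved for an
  arbitrary pair of laws and then applied in both directions.\<close>

lemma finite_sets_pmf_eqI:
  assumes P: "finite_sets_pmf P" and Q: "finite_sets_pmf Q"
    and eq: "\<And>F. finite F \<Longrightarrow> measure_pmf.prob P {D. F \<subseteq> D} = measure_pmf.prob Q {D. F \<subseteq> D}"
  shows "P = Q"
proof -
  have le: "pmf P D0 \<le> pmf Q D0"
    if P: "finite_sets_pmf P" and Q: "finite_sets_pmf Q"
    and eq: "\<And>F. finite F \<Longrightarrow> measure_pmf.prob P {D. F \<subseteq> D} = measure_pmf.prob Q {D. F \<subseteq> D}"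
    for D0 and P Q :: "'a set pmf"
  proof (cases "finite D0")
    case True
    show ?thesis
    proof (rule field_le_epsilon)
      fix e :: real assume "e > 0"
      then obtain A where A: "finite A" "measure_pmf.prob Q {D. \<not> D \<subseteq> A} < e"
        using finite_sets_pmf_tight[OF Q] by blast
      have "pmf P D0 \<le> measure_pmf.prob P {D. D0 \<subseteq> D \<and> D \<inter> (A - D0) = {}}"
        unfolding measure_pmf_single[symmetric] by (rule prob_pmf_mono) auto
      also have "\<dots> = measure_pmf.prob Q {D. D0 \<subseteq> D \<and> D \<inter> (A - D0) = {}}"
        by (rule prob_superset_disjoint_eq) (use eq A True in auto)
      also have "\<dots> \<le> measure_pmf.prob Q {D. D = D0 \<or> \<not> D \<subseteq> A}"
        by (rule prob_pmf_mono) blast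
      also have "\<dots> \<le> measure_pmf.prob Q {D. D = D0} + measure_pmf.prob Q {D. \<not> D \<subseteq> A}"
        by (rule prob_pmf_Un_le)
      also have "\<dots> \<le> pmf Q D0 + e"
        using A(2) by (simp add: measure_pmf_single)
      finally show "pmf P D0 \<le> pmf Q D0 + e" .
    qed
  next
    case False
    then have "pmf P D0 = 0" using P by (auto simp: finite_sets_pmf_def set_pmf_iff)
    then show ?thesis by simp
  qed
  show ?thesis
    by (rule pmf_eqI, rule antisym) (intro le; simp add: P Q eq)+
qed

text \<open>The union bound for possibly infinitely many facts: tightness leaves finitely many, up
  to an error \<open>e\<close>. That \<open>r\<close> only bounds the marginals from above is what
  \<open>zt_le_Z0\<close> needs.\<close>

lemma prob_meets_le_infsum:
  assumes P: "finite_sets_pmf P" and s: "r summable_on X"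
    and r: "\<And>x. x \<in> X \<Longrightarrow> measure_pmf.prob P {D. x \<in> D} \<le> r x"
  shows "measure_pmf.prob P {D. D \<inter> X \<noteq> {}} \<le> infsum r X"
proof (rule field_le_epsilon)
  fix e :: real assume "e > 0"
  then obtain A where A: "finite A" "measure_pmf.prob P {D. \<not> D \<subseteq> A} < e"
    using finite_sets_pmf_tight[OF P] by blast
  have r0: "0 \<le> r x" if "x \<in> X" for x
    using r[OF that] measure_nonneg order_trans by blast
  have "measure_pmf.prob P {D. D \<inter> X \<noteq> {}} \<le> measure_pmf.prob P {D. (\<exists>x\<in>X\<inter>A. x \<in> D) \<or> \<not> D \<subseteq> A}"
    by (rule prob_pmf_mono) blast
  also have "\<dots> \<le> measure_pmf.prob P {D. \<exists>x\<in>X\<inter>A. x \<in> D} + measure_pmf.prob P {D. \<not> D \<subseteq> A}"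
    by (rule prob_pmf_Un_le)
  also have "measure_pmf.prob P {D. \<exists>x\<in>X\<inter>A. x \<in> D} = measure_pmf.prob P (\<Union>x\<in>X\<inter>A. {D. x \<in> D})"
    by (intro arg_cong[where f="measure_pmf.prob P"]) auto
  also have "\<dots> \<le> (\<Sum>x\<in>X\<inter>A. measure_pmf.prob P {D. x \<in> D})"
    by (rule measure_pmf.finite_measure_subadditive_finite) (use A in auto)
  also have "\<dots> \<le> sum r (X \<inter> A)" by (rule sum_mono) (use r in auto)
  also have "\<dots> \<le> infsum r X" by (rule finite_sum_le_infsum) (use s A r0 in auto)
  finally show "measure_pmf.prob P {D. D \<inter> X \<noteq> {}} \<le> infsum r X + e" using A(2) by simp
qed

lemma sum_exclusive_le_prob_meets:
  assumes "finite F" "F \<subseteq> X"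
    and ex: "\<And>x y D. x \<in> X \<Longrightarrow> y \<in> X \<Longrightarrow> x \<noteq> y \<Longrightarrow> D \<in> set_pmf P \<Longrightarrow> x \<in> D \<Longrightarrow> y \<in> D \<Longrightarrow> False"
  shows "(\<Sum>x\<in>F. measure_pmf.prob P {D. x \<in> D}) \<le> measure_pmf.prob P {D. D \<inter> X \<noteq> {}}"
proof -
  have "(\<Sum>x\<in>F. measure_pmf.prob P {D. x \<in> D}) = (\<Sum>x\<in>F. measure_pmf.prob P {D\<in>set_pmf P. x \<in> D})"
    by (intro sum.cong refl prob_pmf_cong) auto
  also have "\<dots> = measure_pmf.prob P (\<Union>x\<in>F. {D\<in>set_pmf P. x \<in> D})"
  proof (rule measure_pmf.finite_measure_finite_Union[symmetric])
    show "disjoint_family_on (\<lambda>x. {D\<in>set_pmf P. x \<in> D}) F"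
      unfolding disjoint_family_on_def using assms(2) ex by blast
  qed (use assms in auto)
  also have "\<dots> \<le> measure_pmf.prob P {D. D \<inter> X \<noteq> {}}"
    by (rule prob_pmf_mono) (use assms in auto)
  finally show ?thesis .
qed

lemma prob_meets_exclusive_has_sum:
  assumes P: "finite_sets_pmf P"
    and ex: "\<And>x y D. x \<in> X \<Longrightarrow> y \<in> X \<Longrightarrow> x \<noteq> y \<Longrightarrow> D \<in> set_pmf P \<Longrightarrow> x \<in> D \<Longrightarrow> y \<in> D \<Longrightarrow> False"
  shows "((\<lambda>x. measure_pmf.prob P {D. x \<in> D}) has_sum measure_pmf.prob P {D. D \<inter> X \<noteq> {}}) X"
proof -
  let ?p = "\<lambda>x. measure_pmf.prob P {D. x \<in> D}"
  have le: "sum ?p F \<le> measure_pmf.prob P {D. D \<inter> X \<noteq> {}}" if "finite F" "F \<subseteq> X" for F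
    using sum_exclusive_le_prob_meets[OF that ex] .
  have s: "?p summable_on X"
    by (rule nonneg_bounded_partial_sums_imp_summable_on[where C="measure_pmf.prob P {D. D \<inter> X \<noteq> {}}"])
       (use le in \<open>auto intro!: eventually_finite_subsets_at_top_weakI\<close>)
  have "infsum ?p X = measure_pmf.prob P {D. D \<inter> X \<noteq> {}}"
    using infsum_le_finite_sums[OF s le] prob_meets_le_infsum[OF P s] by (intro antisym) auto
  then show ?thesis using s by (metis has_sum_infsum)
qed

section \<open>Tuple-independent laws with prescribed marginals\<close>

definition tuple_indep :: "'a set pmf \<Rightarrow> ('a \<Rightarrow> real) \<Rightarrow> bool" where
  "tuple_indep Q r \<longleftrightarrow> finite_sets_pmf Q \<and>
     (\<forall>F. finite F \<longrightarrow> measure_pmf.prob Q {D. F \<subseteq> D} = (\<Prod>f\<in>F. r f))"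

lemma tuple_indep_marginal:
  assumes "tuple_indep Q r"
  shows "measure_pmf.prob Q {D. f \<in> D} = r f"
proof -
  have "measure_pmf.prob Q {D. {f} \<subseteq> D} = prod r {f}"
    using assms unfolding tuple_indep_def by blast
  then show ?thesis by simp
qed

lemma pair_pmf_prob:
  "measure_pmf.prob (pair_pmf P Q) {(x, y). A x \<and> B y} = measure_pmf.prob P {x. A x} * measure_pmf.prob Q {y. B y}"
proof -
  have "measure_pmf.prob (pair_pmf P Q) {(x, y). A x \<and> B y} =
        measure_pmf.prob (pair_pmf P Q) (({x. A x} \<inter> set_pmf P) \<times> ({y. B y} \<inter> set_pmf Q))"
    by (rule prob_pmf_cong) auto
  also have "\<dots> = measure_pmf.prob P ({x. A x} \<inter> set_pmf P) * measure_pmf.prob Q ({y. B y} \<inter> set_pmf Q)"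
    by (rule measure_pmf_prob_product) auto
  finally show ?thesis by (simp add: measure_Int_set_pmf)
qed

text \<open>Drawing the facts inside and outside \<open>I\<close> from two independent copies
  changes nothing, since the product for \<open>F\<close> splits along \<open>I\<close>.
  Independence of events about disjoint sets of facts, infinite ones included, then follows without
  generated sigma-algebras.\<close>

lemma tuple_indep_split:
  assumes Q: "tuple_indep Q r"
  shows "Q = map_pmf (\<lambda>(x, y). x \<inter> I \<union> (y - I)) (pair_pmf Q Q)"
proof (rule finite_sets_pmf_eqI)
  show "finite_sets_pmf Q" using Q by (simp add: tuple_indep_def)
  show "finite_sets_pmf (map_pmf (\<lambda>(x, y). x \<inter> I \<union> (y - I)) (pair_pmf Q Q))"
    using Q by (auto simp: tuple_indep_def finite_sets_pmf_def)
  fix F :: "'a set" assume F: "finite F"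
  have "measure_pmf.prob (map_pmf (\<lambda>(x, y). x \<inter> I \<union> (y - I)) (pair_pmf Q Q)) {D. F \<subseteq> D} =
        measure_pmf.prob (pair_pmf Q Q) {(x, y). F \<inter> I \<subseteq> x \<and> F - I \<subseteq> y}"
    unfolding measure_map_pmf by (intro arg_cong[where f="measure_pmf.prob _"]) auto
  also have "\<dots> = measure_pmf.prob Q {x. F \<inter> I \<subseteq> x} * measure_pmf.prob Q {x. F - I \<subseteq> x}"
    by (rule pair_pmf_prob)
  also have "\<dots> = prod r (F \<inter> I) * prod r (F - I)"
    using Q F by (simp add: tuple_indep_def)
  also have "\<dots> = prod r F"
    using F by (subst prod.union_disjoint[symmetric]) (auto intro!: prod.cong)
  also have "\<dots> = measure_pmf.prob Q {D. F \<subseteq> D}"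
    using Q F by (simp add: tuple_indep_def)
  finally show "measure_pmf.prob Q {D. F \<subseteq> D} =
    measure_pmf.prob (map_pmf (\<lambda>(x, y). x \<inter> I \<union> (y - I)) (pair_pmf Q Q)) {D. F \<subseteq> D}" by simp
qed

definition depends_on :: "('a set \<Rightarrow> bool) \<Rightarrow> 'a set \<Rightarrow> bool" where
  "depends_on E I \<longleftrightarrow> (\<forall>D D'. D \<inter> I = D' \<inter> I \<longrightarrow> E D = E D')"

lemma depends_onD: "depends_on E I \<Longrightarrow> D \<inter> I = D' \<inter> I \<Longrightarrow> E D = E D'"
  unfolding depends_on_def by blast

lemma tuple_indep_conj:
  assumes Q: "tuple_indep Q r" and E: "depends_on E I" and E': "depends_on E' J" and IJ: "I \<inter> J = {}"
  shows "measure_pmf.prob Q {D. E D \<and> E' D} = measure_pmf.prob Q {D. E D} * measure_pmf.prob Q {D. E' D}"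
proof -
  have 1: "E (x \<inter> I \<union> (y - I)) = E x" for x y by (rule depends_onD[OF E]) auto
  have 2: "E' (x \<inter> I \<union> (y - I)) = E' y" for x y by (rule depends_onD[OF E']) (use IJ in auto)
  have "measure_pmf.prob Q {D. E D \<and> E' D} =
        measure_pmf.prob (map_pmf (\<lambda>(x, y). x \<inter> I \<union> (y - I)) (pair_pmf Q Q)) {D. E D \<and> E' D}"
    using tuple_indep_split[OF Q, of I] by simp
  also have "\<dots> = measure_pmf.prob (pair_pmf Q Q) {(x, y). E x \<and> E' y}"
    unfolding measure_map_pmf by (intro arg_cong[where f="measure_pmf.prob _"]) (auto simp: 1 2)
  finally show ?thesis by (simp only: pair_pmf_prob)
qed

lemma tuple_indep_ball:
  assumes Q: "tuple_indep Q r" and "finite K"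
    and "\<And>k. k \<in> K \<Longrightarrow> depends_on (E k) (I k)"
    and "\<And>k l. k \<in> K \<Longrightarrow> l \<in> K \<Longrightarrow> k \<noteq> l \<Longrightarrow> I k \<inter> I l = {}"
  shows "measure_pmf.prob Q {D. \<forall>k\<in>K. E k D} = (\<Prod>k\<in>K. measure_pmf.prob Q {D. E k D})"
  using assms(2-4)
proof (induction K)
  case empty
  then show ?case using measure_pmf.prob_space[of Q] by simp
next
  case (insert k K)
  have "measure_pmf.prob Q {D. E k D \<and> (\<forall>k\<in>K. E k D)} =
        measure_pmf.prob Q {D. E k D} * measure_pmf.prob Q {D. \<forall>k\<in>K. E k D}"
  proof (rule tuple_indep_conj[OF Q])
    show "depends_on (E k) (I k)" using insert by simp
    show "depends_on (\<lambda>D. \<forall>k\<in>K. E k D) (\<Union>k\<in>K. I k)"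
      unfolding depends_on_def
    proof (intro allI impI ball_cong refl)
      fix D D' l assume "D \<inter> (\<Union>k\<in>K. I k) = D' \<inter> (\<Union>k\<in>K. I k)" "l \<in> K"
      then have "D \<inter> I l = D' \<inter> I l" by blast
      then show "E l D = E l D'" 
        using insert.prems(1)[of l] \<open>l \<in> K\<close> by (intro depends_onD[of "E l" "I l"]) auto
    qed
    show "I k \<inter> (\<Union>k\<in>K. I k) = {}" using insert by blast
  qed
  then show ?case using insert by simp
qed

text \<open>\<open>T\<close> may be infinite, so avoidance has no finite product formula. Instead,
  the laws of the traces on \<open>T\<close> agree on supersets, hence agree, and are compared at
  the empty set.\<close>

lemma tuple_indep_avoid_eq:
  assumes Q: "tuple_indep Q r" and Q': "tuple_indep Q' r'" 
    and e: "inj_on e T" "\<And>f. f \<in> T \<Longrightarrow> r (e f) = r' f"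
  shows "measure_pmf.prob Q {D. \<forall>f\<in>T. e f \<notin> D} = measure_pmf.prob Q' {D. \<forall>f\<in>T. f \<notin> D}"
proof -
  have "map_pmf (\<lambda>D. {f\<in>T. e f \<in> D}) Q = map_pmf (\<lambda>D. D \<inter> T) Q'"
  proof (rule finite_sets_pmf_eqI)
    have "finite {f\<in>T. e f \<in> D}" if "D \<in> set_pmf Q" for D
    proof (rule finite_imageD)
      have "finite D" using that Q by (auto simp: tuple_indep_def finite_sets_pmf_def)
      then show "finite (e ` {f\<in>T. e f \<in> D})" by (rule rev_finite_subset) auto
      show "inj_on e {f\<in>T. e f \<in> D}" using e(1) by (rule inj_on_subset) auto
    qed
    then show "finite_sets_pmf (map_pmf (\<lambda>D. {f\<in>T. e f \<in> D}) Q)"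
      by (auto simp: finite_sets_pmf_def)
    show "finite_sets_pmf (map_pmf (\<lambda>D. D \<inter> T) Q')"
      using Q' by (auto simp: finite_sets_pmf_def tuple_indep_def)
    fix F :: "'b set" assume F: "finite F"
    show "measure_pmf.prob (map_pmf (\<lambda>D. {f\<in>T. e f \<in> D}) Q) {D. F \<subseteq> D} =
          measure_pmf.prob (map_pmf (\<lambda>D. D \<inter> T) Q') {D. F \<subseteq> D}"
    proof (cases "F \<subseteq> T")
      case True
      then have "(\<lambda>D. {f\<in>T. e f \<in> D}) -` {D. F \<subseteq> D} = {D. e ` F \<subseteq> D}"
        "(\<lambda>D. D \<inter> T) -` {D. F \<subseteq> D} = {D. F \<subseteq> D}" by auto
      moreover have "prod r (e ` F) = prod r' F"
        using True e by (subst prod.reindex) (auto intro: inj_on_subset intro!: prod.cong)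
      ultimately show ?thesis using Q Q' F by (simp add: tuple_indep_def)
    next
      case False
      then have "(\<lambda>D. {f\<in>T. e f \<in> D}) -` {D. F \<subseteq> D} = {}"
        "(\<lambda>D. D \<inter> T) -` {D. F \<subseteq> D} = {}" by auto
      then show ?thesis by (simp only: measure_map_pmf measure_empty)
    qed
  qed
  then have "measure_pmf.prob (map_pmf (\<lambda>D. {f\<in>T. e f \<in> D}) Q) {{}} = measure_pmf.prob (map_pmf (\<lambda>D. D \<inter> T) Q') {{}}"
    by simp
  moreover have "(\<lambda>D. {f\<in>T. e f \<in> D}) -` {{}} = {D. \<forall>f\<in>T. e f \<notin> D}"
    "(\<lambda>D. D \<inter> T) -` {{}} = {D. \<forall>f\<in>T. f \<notin> D}" by auto
  ultimately show ?thesis by simp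
qed

text \<open>Independent coin flips on \<open>G\<close> form an infinite product measure. Summability
  and Borel-Cantelli make the set of successes finite almost surely, and since \<open>G\<close> has
  only countably many finite subsets, its law is discrete.\<close>

lemma tuple_indep_exists:
  fixes r :: "'a \<Rightarrow> real"
  assumes G: "countable G" and r: "\<And>f. f \<in> G \<Longrightarrow> 0 \<le> r f \<and> r f \<le> 1" and r0: "\<And>f. f \<notin> G \<Longrightarrow> r f = 0"
    and s: "r summable_on G"
  shows "\<exists>Q. tuple_indep Q r \<and> (\<forall>D\<in>set_pmf Q. D \<subseteq> G)"
proof -
  define B where "B f = measure_pmf (bernoulli_pmf (r f))" for f
  interpret product_prob_space B G
    by unfold_locales (auto simp: B_def measure_pmf.emeasure_space_1)
  let ?M = "Pi\<^sub>M G B"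
  have setsB: "sets (B f) = UNIV" for f by (simp add: B_def)
  have coll: "{\<omega>\<in>space ?M. \<omega> f} \<in> sets ?M" if "f \<in> G" for f
    by (rule sets_Collect_single') (use that setsB in auto)
  have prob: "measure ?M {\<omega>\<in>space ?M. \<forall>f\<in>F. \<omega> f} = prod r F" if "finite F" "F \<subseteq> G" for F
  proof -
    have "emeasure ?M {\<omega>\<in>space ?M. \<forall>f\<in>F. \<omega> f \<in> {True}} = (\<Prod>f\<in>F. emeasure (B f) {True})"
      by (rule emeasure_PiM_Collect) (use that setsB in auto)
    also have "\<dots> = (\<Prod>f\<in>F. ennreal (r f))"
      using that r by (intro prod.cong refl) (auto simp: B_def emeasure_pmf_single subset_iff)
    also have "\<dots> = ennreal (prod r F)"
      by (rule prod_ennreal) (use that r in auto)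
    finally show ?thesis
      using that r by (simp add: measure_def prod_nonneg subset_iff)
  qed
  \<comment> \<open>Borel-Cantelli needs events indexed by \<open>nat\<close>; indices outside the
    range of the enumeration, which exist if \<open>G\<close> is finite, get the empty
    event.\<close>
  define A where "A n = {\<omega>\<in>space ?M. n \<in> to_nat_on G ` G \<and> \<omega> (from_nat_into G n)}" for n
  have A_eq: "A n = (if n \<in> to_nat_on G ` G then {\<omega>\<in>space ?M. \<omega> (from_nat_into G n)} else {})" for n
    by (auto simp: A_def)
  have [measurable]: "A n \<in> sets ?M" for n
    using G by (auto simp: A_eq intro!: coll)
  have PA: "measure ?M (A n) = (if n \<in> to_nat_on G ` G then r (from_nat_into G n) else 0)" for n
    using prob[of "{from_nat_into G n}"] G by (auto simp: A_eq)
  have "(\<lambda>n. r (from_nat_into G n)) summable_on (to_nat_on G ` G)"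
    by (subst summable_on_reindex) (use G s in \<open>auto simp: o_def cong: summable_on_cong\<close>)
  then have "(\<lambda>n. measure ?M (A n)) summable_on UNIV"
    by (subst summable_on_cong_neutral[where T="to_nat_on G ` G" and g="\<lambda>n. r (from_nat_into G n)"])
       (auto simp: PA)
  then have "summable (\<lambda>n. measure ?M (A n))"
    by (rule summable_on_UNIV_nonneg_real_iff[THEN iffD1, rotated]) auto
  then have AE: "AE \<omega> in ?M. \<forall>\<^sub>F n in sequentially. \<omega> \<in> space ?M - A n"
    by (intro borel_cantelli_AE1) (auto simp: emeasure_eq_measure)
  \<comment> \<open>The null event of infinitely many successes is sent to the empty set, so that
    \<open>X\<close> takes values in a countable set everywhere.\<close>
  define X where "X \<omega> = (let D = {f\<in>G. \<omega> f} in if finite D then D else {})" for \<omega>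
  have AEX: "AE \<omega> in ?M. X \<omega> = {f\<in>G. \<omega> f}"
    using AE
  proof (eventually_elim)
    case (elim \<omega>)
    then obtain N where N: "\<And>n. n \<ge> N \<Longrightarrow> \<omega> \<in> space ?M - A n"
      by (auto simp: eventually_sequentially)
    have "finite {f\<in>G. \<omega> f}"
    proof (rule finite_imageD)
      have "to_nat_on G f < N" if "f \<in> G" "\<omega> f" for f
        using N[of "to_nat_on G f"] that G by (cases "N \<le> to_nat_on G f") (auto simp: A_def)
      then show "finite (to_nat_on G ` {f\<in>G. \<omega> f})"
        by (intro finite_subset[OF _ finite_lessThan[of N]]) auto
      show "inj_on (to_nat_on G) {f\<in>G. \<omega> f}"
        using inj_on_to_nat_on[OF G] by (rule inj_on_subset) auto
    qed
    then show ?case by (simp add: X_def)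
  qed
  have cFin: "countable {D. finite D \<and> D \<subseteq> G}" using G by (rule countable_Collect_finite_subset)
  have XFin: "X \<omega> \<in> {D. finite D \<and> D \<subseteq> G}" for \<omega> by (auto simp: X_def Let_def)
  have sing: "{\<omega>\<in>space ?M. {f\<in>G. \<omega> f} = D} \<in> sets ?M" if "D \<subseteq> G" for D
  proof -
    have "{\<omega>\<in>space ?M. {f\<in>G. \<omega> f} = D} = {\<omega>\<in>space ?M. \<forall>f\<in>G. \<omega> f \<longleftrightarrow> f \<in> D}" using that by auto
    also have "\<dots> \<in> sets ?M"
    proof (rule sets.sets_Collect_countable_All'[OF _ G])
      fix f assume "f \<in> G"
      show "{\<omega>\<in>space ?M. \<omega> f \<longleftrightarrow> f \<in> D} \<in> sets ?M"
        by (rule sets_Collect_single') (use \<open>f \<in> G\<close> setsB in auto)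
    qed
    finally show ?thesis .
  qed
  \<comment> \<open>A nonempty value excludes the default of \<open>X\<close>; the preimage of the
    empty set is obtained below as the complement of all the others.\<close>
  have ne: "X -` {D} \<inter> space ?M \<in> sets ?M" if D: "D \<in> {D. finite D \<and> D \<subseteq> G}" "D \<noteq> {}" for D
  proof -
    have "X \<omega> = D \<longleftrightarrow> {f\<in>G. \<omega> f} = D" for \<omega>
      using D unfolding X_def Let_def by (cases "finite {f\<in>G. \<omega> f}") (simp only: if_True if_False, metis mem_Collect_eq)+
    then have "X -` {D} \<inter> space ?M = {\<omega>\<in>space ?M. {f\<in>G. \<omega> f} = D}"
      by (simp only: vimage_def singleton_iff) (simp only: Int_def mem_Collect_eq conj_commute)
    then show ?thesis using sing D by simp
  qed
  have Xmeas1: "X \<in> measurable ?M (count_space {D. finite D \<and> D \<subseteq> G})"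
  proof (rule measurable_count_space_eq_countable[OF cFin, THEN iffD2], intro conjI ballI)
    show "X \<in> space ?M \<rightarrow> {D. finite D \<and> D \<subseteq> G}" using XFin by (rule Pi_I)
    fix D assume D: "D \<in> {D. finite D \<and> D \<subseteq> G}"
    show "X -` {D} \<inter> space ?M \<in> sets ?M"
    proof (cases "D = {}")
      case True
      define \<F> where "\<F> = {D. finite D \<and> D \<subseteq> G} - {{}}"
      have X': "X \<omega> \<in> \<F> \<longleftrightarrow> X \<omega> \<noteq> {}" for \<omega> using XFin by (simp add: \<F>_def)
      have cF: "countable \<F>" using cFin by (simp add: \<F>_def)
      have ne': "X -` {D} \<inter> space ?M \<in> sets ?M" if "D \<in> \<F>" for D
        using that ne by (simp add: \<F>_def)
      have "X -` {D} \<inter> space ?M = space ?M - (\<Union>D'\<in>\<F>. X -` {D'} \<inter> space ?M)"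
        unfolding True using X' by auto
      also have "\<dots> \<in> sets ?M"
        by (intro sets.Diff sets.top sets.countable_UN'' ne' cF)
      finally show ?thesis .
    qed (use ne D in simp)
  qed
  have Xmeas: "X \<in> measurable ?M (count_space UNIV)"
    by (rule measurable_compose[OF Xmeas1, of "\<lambda>x. x", simplified]) simp
  define N where "N = distr ?M (count_space UNIV) X"
  have psN: "prob_space N" unfolding N_def by (rule prob_space_distr[OF Xmeas])
  have setsN: "sets N = UNIV" by (simp add: N_def)
  interpret N: prob_space N by fact
  have AEN: "AE D in N. D \<in> {D. finite D \<and> D \<subseteq> G}"
    unfolding N_def by (subst AE_distr_iff[OF Xmeas]) (use XFin in auto)
  \<comment> \<open>The null points of a countable set form a null set; this is what makes
    \<open>N\<close> a pmf.\<close>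
  have "AE D in N. measure N {D} \<noteq> 0"
  proof -
    have "AE D in N. \<forall>D'\<in>{D\<in>{D. finite D \<and> D \<subseteq> G}. measure N {D} = 0}. D \<noteq> D'"
    proof (subst AE_ball_countable)
      show "countable {D\<in>{D. finite D \<and> D \<subseteq> G}. measure N {D} = 0}"
        using cFin by (rule countable_subset[rotated]) auto
      show "\<forall>D'\<in>{D\<in>{D. finite D \<and> D \<subseteq> G}. measure N {D} = 0}. AE D in N. D \<noteq> D'"
      proof
        fix D' assume "D' \<in> {D\<in>{D. finite D \<and> D \<subseteq> G}. measure N {D} = 0}"
        then have "emeasure N {D'} = 0" by (simp add: N.emeasure_eq_measure)
        then show "AE D in N. D \<noteq> D'"
          by (intro AE_I[of _ _ "{D'}"]) (auto simp: setsN)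
      qed
    qed
    with AEN show ?thesis by eventually_elim auto
  qed
  with psN setsN have N_pmf: "measure_pmf (Abs_pmf N) = N"
    by (intro Abs_pmf_inverse) auto
  define Q where "Q = Abs_pmf N"
  have Q: "measure_pmf Q = N" by (simp add: Q_def N_pmf)
  have supp: "\<forall>D\<in>set_pmf Q. finite D \<and> D \<subseteq> G"
    using AEN unfolding Q[symmetric] AE_measure_pmf_iff by auto
  have "measure_pmf.prob Q {D. F \<subseteq> D} = prod r F" if F: "finite F" for F
  proof (cases "F \<subseteq> G")
    case True
    have "measure_pmf.prob Q {D. F \<subseteq> D} = measure ?M (X -` {D. F \<subseteq> D} \<inter> space ?M)"
      unfolding Q N_def by (rule measure_distr[OF Xmeas]) simp
    also have "\<dots> = measure ?M {\<omega>\<in>space ?M. \<forall>f\<in>F. \<omega> f}"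
    proof (rule finite_measure_eq_AE)
      show "AE \<omega> in ?M. (\<omega> \<in> X -` {D. F \<subseteq> D} \<inter> space ?M) = (\<omega> \<in> {\<omega>\<in>space ?M. \<forall>f\<in>F. \<omega> f})"
        using AEX by eventually_elim (use True in auto)
      show "X -` {D. F \<subseteq> D} \<inter> space ?M \<in> sets ?M" using Xmeas by (rule measurable_sets) simp
      show "{\<omega>\<in>space ?M. \<forall>f\<in>F. \<omega> f} \<in> sets ?M"
        by (rule sets.sets_Collect_finite_All) (use coll True F in auto)
    qed
    finally show ?thesis using prob[OF F True] by simp
  next
    case False
    then have "measure_pmf.prob Q {D. F \<subseteq> D} = 0"
      using supp by (subst measure_pmf_zero_iff) auto
    moreover have "prod r F = 0" using False F r0 by (auto intro!: prod_zero)
    ultimately show ?thesis by simp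
  qed
  then have "tuple_indep Q r" using supp by (auto simp: tuple_indep_def finite_sets_pmf_def)
  with supp show ?thesis by blast
qed

section \<open>Block-independent distributions\<close>

text \<open>\<open>blk\<close> labels blocks, so that both conditions on blocks become injectivity:
  on the facts tested for independence, and on each instance of the support.\<close>

definition block_indep :: "'a set pmf \<Rightarrow> ('a \<Rightarrow> 'b) \<Rightarrow> bool" where
  "block_indep P blk \<longleftrightarrow> finite_sets_pmf P \<and>
     (\<forall>F. finite F \<and> F \<subseteq> \<Union> (set_pmf P) \<and> inj_on blk F \<longrightarrow>
        measure_pmf.prob P {D. F \<subseteq> D} = (\<Prod>f\<in>F. measure_pmf.prob P {D. f \<in> D})) \<and>
     (\<forall>D\<in>set_pmf P. inj_on blk D)"

lemma block_indep_prod: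
  assumes "block_indep P blk" "finite F" "F \<subseteq> \<Union> (set_pmf P)" "inj_on blk F"
  shows "measure_pmf.prob P {D. F \<subseteq> D} = (\<Prod>f\<in>F. measure_pmf.prob P {D. f \<in> D})"
  using assms unfolding block_indep_def by blast

lemma block_indep_exclusive:
  assumes "block_indep P blk" "D \<in> set_pmf P" "f \<in> D" "g \<in> D" "blk f = blk g"
  shows "f = g"
  using assms unfolding block_indep_def inj_on_def by blast

text \<open>Induction over the blocks to be avoided: by exclusiveness, the events of meeting
  \<open>F b\<close> in \<open>f\<close> are disjoint, so the sum of their probabilities is
  subtracted. Each of them adds \<open>f\<close> to the required set, hence the general
  \<open>T\<close>.\<close>

lemma block_indep_avoid:
  assumes P: "block_indep P blk" and "finite K"
    and "\<And>b. b \<in> K \<Longrightarrow> finite (F b) \<and> F b \<subseteq> \<Union> (set_pmf P) \<and> blk ` F b \<subseteq> {b}"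
    and "finite T" "T \<subseteq> \<Union> (set_pmf P)" "inj_on blk T" "blk ` T \<inter> K = {}"
  shows "measure_pmf.prob P {D. T \<subseteq> D \<and> D \<inter> (\<Union>b\<in>K. F b) = {}} =
    measure_pmf.prob P {D. T \<subseteq> D} * (\<Prod>b\<in>K. 1 - (\<Sum>f\<in>F b. measure_pmf.prob P {D. f \<in> D}))"
  using assms(2-)
proof (induction K arbitrary: T)
  case empty
  then show ?case by simp
next
  case (insert b K)
  let ?p = "\<lambda>f. measure_pmf.prob P {D. f \<in> D}"
  let ?A = "\<lambda>D. D \<inter> (\<Union>b\<in>K. F b) = {}"
  let ?\<Pi> = "\<Prod>b\<in>K. 1 - sum ?p (F b)"
  have Fb0: "finite (F b) \<and> F b \<subseteq> \<Union> (set_pmf P) \<and> blk ` F b \<subseteq> {b}"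
    by (rule insert.prems(1)) simp
  have Fb: "finite (F b)" "F b \<subseteq> \<Union> (set_pmf P)" "\<And>f. f \<in> F b \<Longrightarrow> blk f = b"
    using Fb0 by (simp_all add: image_subset_iff)
  have IH: "measure_pmf.prob P {D. T' \<subseteq> D \<and> ?A D} = measure_pmf.prob P {D. T' \<subseteq> D} * ?\<Pi>"
    if "finite T'" "T' \<subseteq> \<Union> (set_pmf P)" "inj_on blk T'" "blk ` T' \<inter> K = {}" for T'
  proof (rule insert.IH)
    show "finite (F c) \<and> F c \<subseteq> \<Union> (set_pmf P) \<and> blk ` F c \<subseteq> {c}" if "c \<in> K" for c
      using that by (intro insert.prems(1)) simp
  qed (fact that)+
  note T = insert.prems(2-5)
  have ins: "measure_pmf.prob P {D. insert f T \<subseteq> D \<and> ?A D} = ?p f * measure_pmf.prob P {D. T \<subseteq> D} * ?\<Pi>"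
    if f: "f \<in> F b" for f
  proof -
    have "f \<notin> T" "inj_on blk (insert f T)" using Fb(3)[OF f] T by (fastforce simp: inj_on_def)+
    moreover have "f \<in> \<Union> (set_pmf P)" using Fb f by blast
    ultimately have "measure_pmf.prob P {D. insert f T \<subseteq> D} = ?p f * measure_pmf.prob P {D. T \<subseteq> D}"
      using T by (subst (1 2) block_indep_prod[OF P]) auto
    moreover have "measure_pmf.prob P {D. insert f T \<subseteq> D \<and> ?A D} = measure_pmf.prob P {D. insert f T \<subseteq> D} * ?\<Pi>"
      by (rule IH) (use T insert.hyps Fb(3)[OF f] \<open>inj_on blk (insert f T)\<close> \<open>f \<in> \<Union> (set_pmf P)\<close> in auto)
    ultimately show ?thesis by simp
  qed
  have "measure_pmf.prob P {D. T \<subseteq> D \<and> D \<inter> (\<Union>b\<in>insert b K. F b) = {}} =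
        measure_pmf.prob P {D. (T \<subseteq> D \<and> ?A D) \<and> \<not> D \<inter> F b \<noteq> {}}"
    by (rule prob_pmf_cong) auto
  also have "\<dots> = measure_pmf.prob P {D. T \<subseteq> D \<and> ?A D} - measure_pmf.prob P {D. (T \<subseteq> D \<and> ?A D) \<and> D \<inter> F b \<noteq> {}}"
    by (rule prob_pmf_Diff)
  also have "measure_pmf.prob P {D. (T \<subseteq> D \<and> ?A D) \<and> D \<inter> F b \<noteq> {}} =
        measure_pmf.prob P (\<Union>f\<in>F b. {D\<in>set_pmf P. insert f T \<subseteq> D \<and> ?A D})"
    by (rule prob_pmf_cong) auto
  also have "\<dots> = (\<Sum>f\<in>F b. measure_pmf.prob P {D\<in>set_pmf P. insert f T \<subseteq> D \<and> ?A D})"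
  proof (rule measure_pmf.finite_measure_finite_Union)
    show "disjoint_family_on (\<lambda>f. {D\<in>set_pmf P. insert f T \<subseteq> D \<and> ?A D}) (F b)"
      unfolding disjoint_family_on_def
    proof (intro ballI impI equals0I)
      fix f g D assume fg: "f \<in> F b" "g \<in> F b" "f \<noteq> g"
        and "D \<in> {D\<in>set_pmf P. insert f T \<subseteq> D \<and> ?A D} \<inter> {D\<in>set_pmf P. insert g T \<subseteq> D \<and> ?A D}"
      then have "D \<in> set_pmf P" "f \<in> D" "g \<in> D" by auto
      moreover have "blk f = blk g" using fg Fb(3) by metis
      ultimately show False using block_indep_exclusive[OF P] fg(3) by blast
    qed
  qed (use Fb in auto)
  also have "\<dots> = (\<Sum>f\<in>F b. measure_pmf.prob P {D. insert f T \<subseteq> D \<and> ?A D})"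
    by (intro sum.cong refl prob_pmf_cong) auto
  also have "\<dots> = (\<Sum>f\<in>F b. ?p f * measure_pmf.prob P {D. T \<subseteq> D} * ?\<Pi>)"
    by (intro sum.cong refl ins)
  also have "\<dots> = sum ?p (F b) * (measure_pmf.prob P {D. T \<subseteq> D} * ?\<Pi>)"
    by (simp add: sum_distrib_right mult.assoc)
  also have "measure_pmf.prob P {D. T \<subseteq> D \<and> ?A D} = measure_pmf.prob P {D. T \<subseteq> D} * ?\<Pi>"
    by (rule IH) (use T in auto)
  also have "measure_pmf.prob P {D. T \<subseteq> D} * ?\<Pi> - sum ?p (F b) * (measure_pmf.prob P {D. T \<subseteq> D} * ?\<Pi>) =
      measure_pmf.prob P {D. T \<subseteq> D} * (\<Prod>b\<in>insert b K. 1 - sum ?p (F b))"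
    using insert.hyps by (simp add: algebra_simps)
  finally show ?case .
qed

lemma block_indep_block_sum_le_1:
  assumes P: "block_indep P blk" and "finite F" "blk ` F \<subseteq> {b}"
  shows "(\<Sum>f\<in>F. measure_pmf.prob P {D. f \<in> D}) \<le> 1"
proof -
  have "(\<Sum>f\<in>F. measure_pmf.prob P {D. f \<in> D}) \<le> measure_pmf.prob P {D. D \<inter> F \<noteq> {}}"
    by (rule sum_exclusive_le_prob_meets)
       (use assms block_indep_exclusive[OF P] in \<open>auto simp: image_subset_iff\<close>)
  also have "\<dots> \<le> 1" by simp
  finally show ?thesis .
qed

text \<open>A Borel--Cantelli argument: for a fixed instance of positive probability \<open>\<epsilon>\<close>, the event
  that no other block contributes a fact has probability at least \<open>\<epsilon>\<close>, whereas block
  independence bounds it by \<open>exp (- \<Sum> p f)\<close>.\<close>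

lemma block_indep_summable:
  assumes P: "block_indep P blk"
  shows "(\<lambda>f. measure_pmf.prob P {D. f \<in> D}) summable_on \<Union> (set_pmf P)"
proof -
  let ?p = "\<lambda>f. measure_pmf.prob P {D. f \<in> D}"
  obtain D0 where D0: "D0 \<in> set_pmf P" using set_pmf_not_empty[of P] by blast
  define \<epsilon> where "\<epsilon> = pmf P D0"
  have \<epsilon>: "\<epsilon> > 0" using D0 by (simp add: \<epsilon>_def pmf_positive)
  have fin0: "finite D0" using D0 P by (auto simp: block_indep_def finite_sets_pmf_def)
  have "sum ?p F \<le> - ln \<epsilon> + card (blk ` D0)" if F: "finite F" "F \<subseteq> \<Union> (set_pmf P)" for F
  proof -
    define Fb where "Fb b = {f\<in>F. blk f = b}" for b
    \<comment> \<open>\<open>D0\<close> is only known to avoid the blocks it does not meet; the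
      finitely many others carry mass at most 1 each.\<close>
    let ?K = "blk ` F - blk ` D0"
    have K: "f \<notin> D0" if "f \<in> Fb b" "b \<in> ?K" for f b using that by (auto simp: Fb_def)
    have Fb: "finite (Fb b) \<and> Fb b \<subseteq> \<Union> (set_pmf P) \<and> blk ` Fb b \<subseteq> {b}" for b
      using F by (auto simp: Fb_def)
    have le1: "sum ?p (Fb b) \<le> 1" for b
      by (rule block_indep_block_sum_le_1[OF P, of _ b]) (use Fb in auto)
    have "\<epsilon> \<le> measure_pmf.prob P {D. {} \<subseteq> D \<and> D \<inter> (\<Union>b\<in>?K. Fb b) = {}}"
      unfolding \<epsilon>_def measure_pmf_single[symmetric] by (rule prob_pmf_mono) (use K in blast)
    also have "\<dots> = measure_pmf.prob P {D. {} \<subseteq> D} * (\<Prod>b\<in>?K. 1 - sum ?p (Fb b))"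
      by (rule block_indep_avoid[OF P]) (use Fb F in auto)
    also have "\<dots> = (\<Prod>b\<in>?K. 1 - sum ?p (Fb b))" by simp
    also have "\<dots> \<le> (\<Prod>b\<in>?K. exp (- sum ?p (Fb b)))"
    proof (intro prod_mono conjI)
      fix b show "0 \<le> 1 - sum ?p (Fb b)" using le1[of b] by simp
      show "1 - sum ?p (Fb b) \<le> exp (- sum ?p (Fb b))" using exp_ge_add_one_self[of "- sum ?p (Fb b)"] by linarith
    qed
    also have "\<dots> = exp (- (\<Sum>b\<in>?K. sum ?p (Fb b)))"
      using F by (simp add: exp_sum flip: sum_negf)
    finally have "ln \<epsilon> \<le> - (\<Sum>b\<in>?K. sum ?p (Fb b))"
      using \<epsilon> by (metis exp_gt_zero ln_exp ln_le_cancel_iff)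
    moreover have "(\<Sum>b\<in>blk ` F \<inter> blk ` D0. sum ?p (Fb b)) \<le> card (blk ` D0)"
    proof -
      have "(\<Sum>b\<in>blk ` F \<inter> blk ` D0. sum ?p (Fb b)) \<le> (\<Sum>b\<in>blk ` F \<inter> blk ` D0. 1)"
        by (rule sum_mono) (rule le1)
      also have "\<dots> \<le> card (blk ` D0)" using fin0 by (simp add: card_mono)
      finally show ?thesis .
    qed
    moreover have "sum ?p F = (\<Sum>b\<in>blk ` F. sum ?p (Fb b))"
      unfolding Fb_def using F by (rule_tac sum.image_gen)
    moreover have "(\<Sum>b\<in>blk ` F. sum ?p (Fb b)) =
      (\<Sum>b\<in>blk ` F \<inter> blk ` D0. sum ?p (Fb b)) + (\<Sum>b\<in>?K. sum ?p (Fb b))"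
      by (rule sum.Int_Diff) (use F in auto)
    ultimately show ?thesis by linarith
  qed
  then show ?thesis
    by (intro nonneg_bounded_partial_sums_imp_summable_on eventually_finite_subsets_at_top_weakI) auto
qed

lemma summable_on_small_tail:
  fixes p :: "'a \<Rightarrow> real"
  assumes s: "p summable_on A" and "e > 0" and nn: "\<And>x. x \<in> A \<Longrightarrow> 0 \<le> p x"
  shows "\<exists>H. finite H \<and> H \<subseteq> A \<and> infsum p (A - H) \<le> e"
proof -
  have "(p has_sum infsum p A) A" using s by simp
  then have "\<forall>\<^sub>F F in finite_subsets_at_top A. sum p F > infsum p A - e"
    unfolding has_sum_def by (rule order_tendstoD) (use \<open>e > 0\<close> in auto)
  then obtain H where H: "finite H" "H \<subseteq> A" "sum p H > infsum p A - e"
    unfolding eventually_finite_subsets_at_top by blast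
  have "infsum p (A - H) = infsum p A - infsum p H"
    by (rule infsum_Diff) (use s H in auto)
  with H show ?thesis by (intro exI[of _ H]) auto
qed

text \<open>Only sets of possible facts with at most one fact per block need testing: any other set
  has probability 0 on both sides.\<close>

lemma block_indep_eqI:
  assumes P: "block_indep P blk"
    and Q: "finite_sets_pmf Q" "\<And>D. D \<in> set_pmf Q \<Longrightarrow> D \<subseteq> \<Union> (set_pmf P) \<and> inj_on blk D"
    and eq: "\<And>F. finite F \<Longrightarrow> F \<subseteq> \<Union> (set_pmf P) \<Longrightarrow> inj_on blk F \<Longrightarrow>
      measure_pmf.prob Q {D. F \<subseteq> D} = (\<Prod>f\<in>F. measure_pmf.prob P {D. f \<in> D})"
  shows "Q = P"
proof (rule finite_sets_pmf_eqI)
  show "finite_sets_pmf Q" by (rule Q)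
  show "finite_sets_pmf P" using P by (simp add: block_indep_def)
  fix F :: "'a set" assume F: "finite F"
  show "measure_pmf.prob Q {D. F \<subseteq> D} = measure_pmf.prob P {D. F \<subseteq> D}"
  proof (cases "F \<subseteq> \<Union> (set_pmf P) \<and> inj_on blk F")
    case True
    then show ?thesis using eq[OF F] block_indep_prod[OF P F] by simp
  next
    case False
    have *: "\<not> F \<subseteq> D" if "D \<subseteq> \<Union> (set_pmf P)" "inj_on blk D" for D
      using False that by (meson inj_on_subset subset_trans)
    have "\<not> F \<subseteq> D" if "D \<in> set_pmf Q" for D using Q(2)[OF that] by (elim conjE) (rule *)
    moreover have "\<not> F \<subseteq> D" if D: "D \<in> set_pmf P" for D
    proof -
      have "D \<subseteq> \<Union> (set_pmf P)" using D by (rule Union_upper)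
      moreover have "inj_on blk D" using D P by (simp add: block_indep_def)
      ultimately show ?thesis by (rule *)
    qed
    ultimately have "measure_pmf.prob Q {D. F \<subseteq> D} = 0" "measure_pmf.prob P {D. F \<subseteq> D} = 0"
      by (simp_all add: measure_pmf_zero_iff disjoint_iff)
    then show ?thesis by simp
  qed
qed

section \<open>Selecting one fact per block\<close>

text \<open>The probabilistic core, free of relational syntax: of the encodings \<open>e\<close> and
  \<open>z\<close> only injectivity and disjointness matter. Rank 0 marks the tail; every other
  nonempty cell is a single head. \<open>z b n\<close> exists for all \<open>n\<close>, so that
  activity is defined uniformly, although only \<open>z b 0\<close> will ever be present.\<close>

locale block_selection =
  fixes P :: "'a set pmf" and facts :: "'a set" and blk :: "'a \<Rightarrow> 'b" and rk :: "'a \<Rightarrow> nat"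
    and e :: "'a \<Rightarrow> 'i" and z :: "'b \<Rightarrow> nat \<Rightarrow> 'i"
  assumes P: "block_indep P blk"
    and facts_eq: "facts = \<Union> (set_pmf P)"
    and inj_e: "inj_on e (facts)"
    and inj_z: "inj_on (case_prod z) (blk ` facts \<times> UNIV)"
    and e_neq_z: "\<And>f g n. f \<in> facts \<Longrightarrow> g \<in> facts \<Longrightarrow> e f \<noteq> z (blk g) n"
    and finite_heads: "finite {f \<in> facts. rk f \<noteq> 0}"
    and inj_heads: "\<And>f g. f \<in> facts \<Longrightarrow> g \<in> facts \<Longrightarrow> blk f = blk g \<Longrightarrow>
      rk f = rk g \<Longrightarrow> rk f \<noteq> 0 \<Longrightarrow> f = g"
    and small_tail: "infsum (\<lambda>f. measure_pmf.prob P {D. f \<in> D}) {f \<in> facts. rk f = 0} \<le> 1 / 4"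
begin

section \<open>Marginals of the facts and blockers\<close>

abbreviation p :: "'a \<Rightarrow> real" where "p f \<equiv> measure_pmf.prob P {D. f \<in> D}"

definition act :: "'i set \<Rightarrow> 'a \<Rightarrow> bool" where
  "act D f \<longleftrightarrow> e f \<in> D \<and> z (blk f) (rk f) \<notin> D \<and>
     (\<forall>g\<in>facts. blk g = blk f \<and> rk g = rk f \<and> e g \<in> D \<longrightarrow> g = f)"

definition pred :: "'a \<Rightarrow> 'a set" where
  "pred f = {g\<in>facts. blk g = blk f \<and> rk g < rk f}"

definition out :: "'i set \<Rightarrow> 'a set" where
  "out D = {f\<in>facts. act D f \<and> (\<forall>g\<in>pred f. \<not> act D g)}"

definition tails :: "'b \<Rightarrow> 'a set" where
  "tails b = {f\<in>facts. blk f = b \<and> rk f = 0}"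

definition q :: "'b \<Rightarrow> real" where
  "q b = measure_pmf.prob P {D. D \<inter> tails b \<noteq> {}}"

text \<open>The prescribed probability that the tail cell of \<open>b\<close> is empty, blocker
  included.\<close>

definition zt :: "'b \<Rightarrow> real" where
  "zt b = 1 - 2 * q b"

text \<open>In the tail, the number with odds \<open>r / (1 - r) = p / zt\<close>. For a head, the
  denominator is the probability that no predecessor is in the instance, so by exclusiveness this is
  the conditional probability of \<open>f\<close>.\<close>

definition r :: "'a \<Rightarrow> real" where
  "r f = (if f \<notin> facts then 0 else if rk f = 0 then p f / (zt (blk f) + p f)
          else p f / (1 - measure_pmf.prob P {D. D \<inter> pred f \<noteq> {}}))"

lemma finite_sets_P: "finite_sets_pmf P"
  using P by (simp add: block_indep_def)

lemma countable_facts: "countable facts"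
  unfolding facts_eq using finite_sets_P by (rule finite_sets_pmf_countable)

lemma p_pos: "f \<in> facts \<Longrightarrow> 0 < p f"
  by (auto simp: facts_eq measure_pmf_posI)

lemma p_summable: "p summable_on facts"
  unfolding facts_eq using P by (rule block_indep_summable)

lemma exclusive_has_sum:
  assumes "blk ` X \<subseteq> {b}"
  shows "(p has_sum measure_pmf.prob P {D. D \<inter> X \<noteq> {}}) X"
proof (rule prob_meets_exclusive_has_sum[OF finite_sets_P])
  fix x y D assume "x \<in> X" "y \<in> X" "x \<noteq> y" "D \<in> set_pmf P" "x \<in> D" "y \<in> D"
  moreover have "blk x = blk y" using assms \<open>x \<in> X\<close> \<open>y \<in> X\<close> by auto
  ultimately show False using block_indep_exclusive[OF P] by blast
qed

lemma q_has_sum: "(p has_sum q b) (tails b)"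
  unfolding q_def by (rule exclusive_has_sum[of _ b]) (auto simp: tails_def)

lemma q_nonneg: "0 \<le> q b"
  by (simp add: q_def)

lemma q_le: "q b \<le> 1 / 4"
proof -
  have "q b = infsum p (tails b)" using q_has_sum[of b] by (simp add: infsumI)
  also have "\<dots> \<le> infsum p {f\<in>facts. rk f = 0}"
  proof (rule infsum_mono2)
    show "p summable_on tails b" using q_has_sum[of b] by (rule has_sum_imp_summable)
    show "p summable_on {f\<in>facts. rk f = 0}"
      by (rule summable_on_subset_banach[OF p_summable]) auto
  qed (auto simp: tails_def)
  finally show ?thesis using small_tail by simp
qed

text \<open>An instance with \<open>f\<close> has none of its predecessors. Together with
  \<open>p f > 0\<close> this makes the denominator for a head positive and its marginal at most
  1.\<close>

lemma p_le_head: "p f \<le> 1 - measure_pmf.prob P {D. D \<inter> pred f \<noteq> {}}"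
proof -
  have "p f \<le> measure_pmf.prob P {D. True \<and> \<not> D \<inter> pred f \<noteq> {}}"
  proof (rule prob_pmf_mono)
    fix D assume D: "D \<in> set_pmf P" "D \<in> {D. f \<in> D}"
    have "g \<notin> D" if "g \<in> pred f" for g
      using block_indep_exclusive[OF P D(1), of g f] D that by (auto simp: pred_def)
    then show "D \<in> {D. True \<and> \<not> D \<inter> pred f \<noteq> {}}" by blast
  qed
  also have "\<dots> = 1 - measure_pmf.prob P {D. D \<inter> pred f \<noteq> {}}"
    by (subst prob_pmf_Diff) simp
  finally show ?thesis .
qed

lemma r_tail:
  assumes "f \<in> facts" "rk f = 0"
  shows "0 \<le> r f" "r f < 1" "r f \<le> p f * (1 / zt (blk f))"
proof -
  have zt: "0 < zt (blk f)" using q_le[of "blk f"] by (simp add: zt_def)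
  have p: "0 < p f" using assms by (rule_tac p_pos)
  have r: "r f = p f / (zt (blk f) + p f)" using assms by (simp add: r_def)
  show "0 \<le> r f" "r f < 1" using zt p by (auto simp: r)
  show "r f \<le> p f * (1 / zt (blk f))" using zt p by (simp add: r frac_le)
qed

lemma r_head:
  assumes "f \<in> facts" "rk f \<noteq> 0"
  shows "0 \<le> r f" "r f \<le> 1" "r f * (1 - measure_pmf.prob P {D. D \<inter> pred f \<noteq> {}}) = p f"
  using assms p_pos[of f] p_le_head[of f] by (auto simp: r_def)

lemma r_bounds: "0 \<le> r f" "r f \<le> 1"
  using r_tail[of f] r_head[of f] by (cases "f \<in> facts"; cases "rk f = 0"; force simp: r_def)+

lemma r_summable: "r summable_on facts"
proof -
  let ?H = "{f\<in>facts. rk f \<noteq> 0}" and ?T = "{f\<in>facts. rk f = 0}"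
  have "r summable_on ?T"
  proof (rule summable_on_comparison_test)
    show "(\<lambda>f. p f * 2) summable_on ?T"
      by (intro summable_on_cmult_left summable_on_subset_banach[OF p_summable]) auto
    fix f assume f: "f \<in> ?T"
    \<comment> \<open>The factor 2 is \<open>1 / zt \<le> 2\<close>, from
      \<open>q \<le> 1 / 4\<close>.\<close>
    have "p f * (1 / zt (blk f)) \<le> p f * 2"
      using q_le[of "blk f"] by (intro mult_left_mono) (auto simp: zt_def field_simps)
    then show "r f \<le> p f * 2" using r_tail(3)[of f] f by auto
  qed (rule r_bounds)
  moreover have "r summable_on ?H" using finite_heads by simp
  ultimately have "r summable_on (?H \<union> ?T)"
    by (intro summable_on_Un_disjoint) auto
  moreover have "?H \<union> ?T = facts" by auto
  ultimately show ?thesis by simp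
qed

text \<open>\<open>Z0 b\<close> is the probability that no tail fact of block \<open>b\<close> is present. It is read off an
  auxiliary tuple-independent distribution, since the marginals of \<open>Q\<close> below refer to it.\<close>

definition Q0 :: "'a set pmf" where
  "Q0 = (SOME Q. tuple_indep Q r)"

definition Z0 :: "'b \<Rightarrow> real" where
  "Z0 b = measure_pmf.prob Q0 {D. \<forall>f\<in>tails b. f \<notin> D}"

text \<open>Solves \<open>(1 - \<beta> b) * Z0 b = zt b\<close>.\<close>

definition \<beta> :: "'b \<Rightarrow> real" where
  "\<beta> b = 1 - zt b / Z0 b"

lemma Q0: "tuple_indep Q0 r"
proof -
  have "\<exists>Q. tuple_indep Q r"
    using tuple_indep_exists[OF countable_facts, of r] r_bounds r_summable by (metis r_def)
  then show ?thesis unfolding Q0_def by (rule someI_ex)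
qed

text \<open>The union bound gives \<open>Z0 \<ge> 1 - q / zt\<close>, and
  \<open>1 - q / zt \<ge> zt\<close> amounts to \<open>4 * q * q \<le> q\<close>.\<close>

lemma zt_le_Z0: "zt b \<le> Z0 b"
proof -
  have zt: "0 < zt b" "q b \<ge> 0" "q b \<le> 1 / 4"
    using q_le[of b] q_nonneg[of b] by (auto simp: zt_def)
  have hs: "((\<lambda>f. p f * (1 / zt b)) has_sum (q b * (1 / zt b))) (tails b)"
    by (rule has_sum_cmult_left[OF q_has_sum])
  have "measure_pmf.prob Q0 {D. D \<inter> tails b \<noteq> {}} \<le> infsum (\<lambda>f. p f * (1 / zt b)) (tails b)"
  proof (rule prob_meets_le_infsum)
    show "finite_sets_pmf Q0" using Q0 by (simp add: tuple_indep_def)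
    show "(\<lambda>f. p f * (1 / zt b)) summable_on tails b" using hs by (rule has_sum_imp_summable)
    show "measure_pmf.prob Q0 {D. f \<in> D} \<le> p f * (1 / zt b)" if "f \<in> tails b" for f
      using r_tail(3)[of f] that by (simp add: tuple_indep_marginal[OF Q0] tails_def)
  qed
  also have "\<dots> = q b / zt b" using infsumI[OF hs] by simp
  finally have 1: "measure_pmf.prob Q0 {D. D \<inter> tails b \<noteq> {}} \<le> q b / zt b" .
  have "Z0 b = measure_pmf.prob Q0 {D. True \<and> \<not> D \<inter> tails b \<noteq> {}}"
    unfolding Z0_def by (rule prob_pmf_cong) auto
  also have "\<dots> = 1 - measure_pmf.prob Q0 {D. D \<inter> tails b \<noteq> {}}"
    by (subst prob_pmf_Diff) simp
  finally have 2: "1 - q b / zt b \<le> Z0 b" using 1 by simp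
  have "q b * (4 * q b) \<le> q b * 1" using zt by (intro mult_left_mono) auto
  then have "zt b * zt b \<le> zt b - q b" by (simp add: zt_def algebra_simps)
  then have "zt b \<le> 1 - q b / zt b" using zt(1) by (simp add: field_simps)
  with 2 show ?thesis by simp
qed

text \<open>The upper bound comes from \<open>Z0 b \<le> 1\<close>; it makes the blockers of all
  blocks summable, since the \<open>q b\<close> are.\<close>

lemma \<beta>_bounds: "0 \<le> \<beta> b" "\<beta> b \<le> 2 * q b"
proof -
  have zt: "0 < zt b" using q_le[of b] by (auto simp: zt_def)
  have Z: "0 < Z0 b" "Z0 b \<le> 1" using zt zt_le_Z0[of b] by (auto simp: Z0_def)
  show "0 \<le> \<beta> b" using zt zt_le_Z0[of b] Z by (simp add: \<beta>_def)
  have "zt b * Z0 b \<le> zt b * 1" using zt Z by (intro mult_left_mono) auto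
  then have "zt b \<le> zt b / Z0 b" using Z by (simp add: field_simps)
  then show "\<beta> b \<le> 2 * q b" by (simp add: \<beta>_def zt_def)
qed

lemma q_summable: "q summable_on blk ` facts"
proof -
  have inj: "inj_on snd (Sigma (blk ` facts) tails)"
    by (auto simp: inj_on_def tails_def)
  have "p summable_on (snd ` Sigma (blk ` facts) tails)"
    by (rule summable_on_subset_banach[OF p_summable]) (auto simp: tails_def)
  then have "(\<lambda>(b, f). p f) summable_on Sigma (blk ` facts) tails"
    by (subst (asm) summable_on_reindex[OF inj]) (simp add: o_def case_prod_unfold)
  then have "(\<lambda>b. infsum p (tails b)) summable_on blk ` facts"
    by (rule summable_on_Sigma_banach)
  moreover have "infsum p (tails b) = q b" for b using q_has_sum[of b] by (rule infsumI)
  ultimately show ?thesis by simp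
qed

text \<open>Head cells get no blocker: each holds one fact, whose marginal is set directly.\<close>

definition support :: "'i set" where
  "support = e ` facts \<union> (\<lambda>b. z b 0) ` blk ` facts"

definition \<rho> :: "'i \<Rightarrow> real" where
  "\<rho> i = (if i \<in> e ` facts then r (inv_into facts e i)
     else if i \<in> (\<lambda>b. z b 0) ` blk ` facts then \<beta> (inv_into (blk ` facts) (\<lambda>b. z b 0) i) else 0)"

definition Q :: "'i set pmf" where
  "Q = (SOME Q. tuple_indep Q \<rho> \<and> (\<forall>D\<in>set_pmf Q. D \<subseteq> support))"

lemma inj_z0: "inj_on (\<lambda>b. z b 0) (blk ` facts)"
proof (rule inj_onI)
  fix b c assume bc: "b \<in> blk ` facts" "c \<in> blk ` facts" and eq: "z b 0 = z c 0"
  have "(b, 0) = (c, 0::nat)" by (rule inj_onD[OF inj_z]) (use bc eq in simp_all)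
  then show "b = c" by simp
qed

lemma \<rho>_e: "f \<in> facts \<Longrightarrow> \<rho> (e f) = r f"
  using inj_e by (simp add: \<rho>_def)

lemma e_notin_z: "i \<in> (\<lambda>b. z b 0) ` blk ` facts \<Longrightarrow> i \<notin> e ` facts"
proof
  assume "i \<in> (\<lambda>b. z b 0) ` blk ` facts" "i \<in> e ` facts"
  then obtain f g where "f \<in> facts" "g \<in> facts" "e f = z (blk g) 0" by fastforce
  then show False using e_neq_z by blast
qed

lemma \<rho>_z: "b \<in> blk ` facts \<Longrightarrow> \<rho> (z b 0) = \<beta> b"
  unfolding \<rho>_def using e_notin_z[of "z b 0"] inv_into_f_f[OF inj_z0, of b] by simp

lemma Q: "tuple_indep Q \<rho>" and Q_support: "D \<in> set_pmf Q \<Longrightarrow> D \<subseteq> support"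
proof -
  have b1: "\<beta> b \<le> 1" for b using \<beta>_bounds(2)[of b] q_le[of b] by simp
  have "\<exists>Q. tuple_indep Q \<rho> \<and> (\<forall>D\<in>set_pmf Q. D \<subseteq> support)"
  proof (rule tuple_indep_exists)
    show "countable support" using countable_facts by (simp add: support_def)
    show "0 \<le> \<rho> f \<and> \<rho> f \<le> 1" for f
      using r_bounds \<beta>_bounds(1) b1 by (simp add: \<rho>_def)
    show "\<rho> f = 0" if "f \<notin> support" for f using that by (simp add: \<rho>_def support_def)
    have "(\<rho> \<circ> e) summable_on facts"
      using r_summable by (subst summable_on_cong[of _ _ r]) (auto simp: \<rho>_e)
    then have 1: "\<rho> summable_on (e ` facts)" by (subst summable_on_reindex[OF inj_e])
    have "\<beta> summable_on (blk ` facts)"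
      by (rule summable_on_comparison_test[OF summable_on_cmult_right[OF q_summable, of 2]])
         (use \<beta>_bounds in auto)
    then have "(\<rho> \<circ> (\<lambda>b. z b 0)) summable_on blk ` facts"
      by (subst summable_on_cong[of _ _ \<beta>]) (auto simp: \<rho>_z)
    then have 2: "\<rho> summable_on ((\<lambda>b. z b 0) ` blk ` facts)" by (subst summable_on_reindex[OF inj_z0])
    show "\<rho> summable_on support"
      unfolding support_def by (rule summable_on_Un_disjoint[OF 1 2]) (use e_notin_z in blast)
  qed
  then have "tuple_indep Q \<rho> \<and> (\<forall>D\<in>set_pmf Q. D \<subseteq> support)" unfolding Q_def by (rule someI_ex)
  then show "tuple_indep Q \<rho>" "D \<in> set_pmf Q \<Longrightarrow> D \<subseteq> support" by blast+
qed

section \<open>Cells as independent sets of coordinates\<close>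

definition cell :: "'b \<Rightarrow> nat \<Rightarrow> 'i set" where
  "cell b n = insert (z b n) (e ` {g\<in>facts. blk g = b \<and> rk g = n})"

lemma cell_disjoint:
  assumes "b \<in> blk ` facts" "c \<in> blk ` facts" "(b, n) \<noteq> (c, m)"
  shows "cell b n \<inter> cell c m = {}"
proof -
  have "z b n \<noteq> z c m"
    using inj_onD[OF inj_z, of "(b, n)" "(c, m)"] assms by auto
  moreover have "z b n \<noteq> e g" "z c m \<noteq> e g" if "g \<in> facts" for g
    using e_neq_z[OF that] assms by (metis imageE)+
  moreover have "e g \<noteq> e h" if "g \<in> facts" "h \<in> facts" "g \<noteq> h" for g h
    using inj_e that by (auto dest: inj_onD)
  ultimately show ?thesis using assms(3) unfolding cell_def by (fastforce simp: disjoint_iff)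
qed

lemma act_depends: "f \<in> facts \<Longrightarrow> depends_on (\<lambda>D. act D f) (cell (blk f) (rk f))"
  unfolding depends_on_def
proof (intro allI impI)
  fix D D' assume f: "f \<in> facts" and eq: "D \<inter> cell (blk f) (rk f) = D' \<inter> cell (blk f) (rk f)"
  have i: "i \<in> D \<longleftrightarrow> i \<in> D'" if "i \<in> cell (blk f) (rk f)" for i using eq that by blast
  have "e f \<in> D \<longleftrightarrow> e f \<in> D'" "z (blk f) (rk f) \<in> D \<longleftrightarrow> z (blk f) (rk f) \<in> D'"
    by (rule i, use f in \<open>simp add: cell_def\<close>)+
  moreover have "e g \<in> D \<longleftrightarrow> e g \<in> D'" if "g \<in> facts" "blk g = blk f" "rk g = rk f" for g
    by (rule i) (use that in \<open>simp add: cell_def\<close>)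
  ultimately show "act D f = act D' f" unfolding act_def by metis
qed

lemma depends_on_mem: "depends_on (\<lambda>D. i \<in> D) {i}" and depends_on_notmem: "depends_on (\<lambda>D. i \<notin> D) {i}"
  unfolding depends_on_def by blast+

lemma depends_on_none: "depends_on (\<lambda>D. \<forall>f\<in>T. e f \<notin> D) (e ` T)"
  unfolding depends_on_def by blast

lemma prob_notmem: "measure_pmf.prob Q {D. i \<notin> D} = 1 - \<rho> i"
proof -
  have "measure_pmf.prob Q {D. True \<and> \<not> i \<in> D} = 1 - \<rho> i"
    by (subst prob_pmf_Diff) (simp add: tuple_indep_marginal[OF Q])
  then show ?thesis by simp
qed

text \<open>With \<open>W\<close> for the absence of the other tail facts,
  \<open>Z0 = (1 - r f) * W\<close>. So activity has probability
  \<open>r f * (1 - \<beta>) * W\<close>, the odds of \<open>f\<close> times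
  \<open>(1 - \<beta>) * Z0 = zt\<close>. Keeping \<open>W\<close> a probability avoids an infinite
  product.\<close>

lemma prob_act_tail:
  assumes f: "f \<in> facts" "rk f = 0"
  shows "measure_pmf.prob Q {D. act D f} = p f"
proof -
  let ?b = "blk f" and ?T = "tails (blk f) - {f}"
  define W where "W = measure_pmf.prob Q {D. \<forall>g\<in>?T. e g \<notin> D}"
  have b: "?b \<in> blk ` facts" using f by simp
  have ft: "f \<in> tails ?b" using f by (simp add: tails_def)
  have T: "?T \<subseteq> facts" by (auto simp: tails_def)
  have e_f: "e f \<notin> e ` ?T"
  proof
    assume "e f \<in> e ` ?T"
    then obtain g where "g \<in> ?T" "e f = e g" by blast
    then show False using inj_onD[OF inj_e, of f g] f T by blast
  qed
  have "Z0 ?b = measure_pmf.prob Q {D. \<forall>f\<in>tails ?b. e f \<notin> D}"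
    unfolding Z0_def
    by (rule tuple_indep_avoid_eq[OF Q Q0, symmetric])
       (use inj_on_subset[OF inj_e, of "tails ?b"] in \<open>auto simp: tails_def \<rho>_e\<close>)
  also have "\<dots> = measure_pmf.prob Q {D. e f \<notin> D \<and> (\<forall>g\<in>?T. e g \<notin> D)}"
    using ft by (intro prob_pmf_cong) auto
  also have "\<dots> = measure_pmf.prob Q {D. e f \<notin> D} * W"
    unfolding W_def
    by (rule tuple_indep_conj[OF Q depends_on_notmem depends_on_none]) (use e_f in simp)
  finally have Z0_eq: "Z0 ?b = (1 - r f) * W" using f by (simp add: prob_notmem \<rho>_e)
  have "measure_pmf.prob Q {D. act D f} =
      measure_pmf.prob Q {D. e f \<in> D \<and> (z ?b 0 \<notin> D \<and> (\<forall>g\<in>?T. e g \<notin> D))}"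
    using f by (intro prob_pmf_cong) (auto simp: act_def tails_def)
  also have "\<dots> = measure_pmf.prob Q {D. e f \<in> D} * measure_pmf.prob Q {D. z ?b 0 \<notin> D \<and> (\<forall>g\<in>?T. e g \<notin> D)}"
  proof (rule tuple_indep_conj[OF Q depends_on_mem])
    show "depends_on (\<lambda>D. z ?b 0 \<notin> D \<and> (\<forall>g\<in>?T. e g \<notin> D)) (insert (z ?b 0) (e ` ?T))"
      unfolding depends_on_def by blast
    show "{e f} \<inter> insert (z ?b 0) (e ` ?T) = {}" using e_f e_neq_z[OF f(1) f(1)] by simp
  qed
  also have "measure_pmf.prob Q {D. z ?b 0 \<notin> D \<and> (\<forall>g\<in>?T. e g \<notin> D)} = measure_pmf.prob Q {D. z ?b 0 \<notin> D} * W"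
    unfolding W_def
  proof (rule tuple_indep_conj[OF Q depends_on_notmem depends_on_none])
    show "{z ?b 0} \<inter> e ` ?T = {}" using e_neq_z[OF _ f(1), of _ 0] T by fastforce
  qed
  also have "measure_pmf.prob Q {D. e f \<in> D} * (measure_pmf.prob Q {D. z ?b 0 \<notin> D} * W) = r f * ((1 - \<beta> ?b) * W)"
    using f b by (simp add: prob_notmem \<rho>_e \<rho>_z tuple_indep_marginal[OF Q])
  also have "\<dots> = p f"
  proof -
    have zt: "0 < zt ?b" using q_le[of ?b] by (auto simp: zt_def)
    have Z: "0 < Z0 ?b" using zt zt_le_Z0[of ?b] by simp
    have r: "r f = p f / (zt ?b + p f)" using f by (simp add: r_def)
    have s: "0 < zt ?b + p f" using zt p_pos[OF f(1)] by simp
    have r1: "1 - r f = zt ?b / (zt ?b + p f)" using s by (simp add: r field_simps)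
    have W: "W = Z0 ?b * (zt ?b + p f) / zt ?b" using Z0_eq s zt unfolding r1 by (simp add: field_simps)
    show ?thesis using zt Z s by (simp add: \<beta>_def r W)
  qed
  finally show ?thesis .
qed

text \<open>A head is alone in its cell and its blocker lies outside the support, so being active is
  being present.\<close>

lemma prob_act_head:
  assumes f: "f \<in> facts" "rk f \<noteq> 0"
  shows "measure_pmf.prob Q {D. act D f} = r f"
proof -
  have "measure_pmf.prob Q {D. act D f} = measure_pmf.prob Q {D. e f \<in> D}"
  proof (rule prob_pmf_cong)
    fix D assume D: "D \<in> set_pmf Q"
    have "z (blk f) (rk f) \<notin> support"
      unfolding support_def
    proof
      assume "z (blk f) (rk f) \<in> e ` facts \<union> (\<lambda>b. z b 0) ` blk ` facts"
      then consider g where "g \<in> facts" "z (blk f) (rk f) = e g"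
        | g where "g \<in> facts" "z (blk f) (rk f) = z (blk g) 0" by blast
      then show False
      proof cases
        case 1
        then show ?thesis using e_neq_z[OF 1(1) f(1), of "rk f"] by simp
      next
        case 2
        then show ?thesis using inj_onD[OF inj_z, of "(blk f, rk f)" "(blk g, 0)"] f by simp
      qed
    qed
    then have "z (blk f) (rk f) \<notin> D" using Q_support[OF D] by blast
    moreover have "g = f" if "g \<in> facts" "blk g = blk f" "rk g = rk f" for g
      using inj_heads[of g f] that f by simp
    ultimately show "D \<in> {D. act D f} \<longleftrightarrow> D \<in> {D. e f \<in> D}" by (auto simp: act_def)
  qed
  then show ?thesis using f by (simp add: tuple_indep_marginal[OF Q] \<rho>_e)
qed

text \<open>The common form for both kinds of facts: a tail fact has no predecessors, so the factor
  is 1.\<close>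

lemma prob_act:
  assumes "f \<in> facts"
  shows "measure_pmf.prob Q {D. act D f} * (1 - measure_pmf.prob P {D. D \<inter> pred f \<noteq> {}}) = p f"
  using assms prob_act_tail[of f] prob_act_head[of f] r_head(3)[of f]
  by (cases "rk f = 0") (auto simp: pred_def)

lemma act_unique: "act D f \<Longrightarrow> act D g \<Longrightarrow> f \<in> facts \<Longrightarrow> g \<in> facts \<Longrightarrow> blk f = blk g \<Longrightarrow> rk f = rk g \<Longrightarrow> f = g"
  unfolding act_def by metis

section \<open>The law of the selected facts\<close>

lemma out_inj: "inj_on blk (out D)"
proof (rule inj_onI)
  fix f g assume *: "f \<in> out D" "g \<in> out D" "blk f = blk g"
  consider "rk f < rk g" | "rk g < rk f" | "rk f = rk g" by linarith
  then show "f = g"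
  proof cases
    case 3
    then show ?thesis using * act_unique[of D f g] by (simp add: out_def)
  qed (use * in \<open>auto simp: out_def pred_def\<close>)
qed

lemma out_subset: "out D \<subseteq> facts"
  by (auto simp: out_def)

lemma finite_out:
  assumes "D \<in> set_pmf Q"
  shows "finite (out D)"
proof (rule finite_imageD)
  have "finite D" using assms Q by (auto simp: tuple_indep_def finite_sets_pmf_def)
  then show "finite (e ` out D)" by (rule rev_finite_subset) (auto simp: out_def act_def)
  show "inj_on e (out D)" using inj_e out_subset by (rule inj_on_subset)
qed

text \<open>An active predecessor of least rank is itself selected. So the absence of active
  predecessors can be read off the output, where facts of one block are exclusive.\<close>

lemma ex_act_iff: "f \<in> facts \<Longrightarrow> (\<exists>g\<in>pred f. act D g) \<longleftrightarrow> out D \<inter> pred f \<noteq> {}"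
proof
  assume f: "f \<in> facts" and "\<exists>g\<in>pred f. act D g"
  then have "\<exists>n g. g \<in> pred f \<and> act D g \<and> rk g = n" by blast
  then obtain n where n: "\<exists>g. g \<in> pred f \<and> act D g \<and> rk g = n"
    and min: "\<And>m. m < n \<Longrightarrow> \<not> (\<exists>g. g \<in> pred f \<and> act D g \<and> rk g = m)"
    by (auto simp: exists_least_iff[of "\<lambda>n. \<exists>g. g \<in> pred f \<and> act D g \<and> rk g = n"])
  then obtain g where g: "g \<in> pred f" "act D g" "rk g = n" by blast
  have "\<not> act D h" if "h \<in> pred g" for h
    using min[of "rk h"] that g by (auto simp: pred_def)
  then have "g \<in> out D" using g by (auto simp: out_def pred_def)
  then show "out D \<inter> pred f \<noteq> {}" using g by blast
qed (auto simp: out_def)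

lemma none_depends:
  assumes "f \<in> facts"
  shows "depends_on (\<lambda>D. \<forall>g\<in>pred f. \<not> act D g) (\<Union>n<rk f. cell (blk f) n)"
  unfolding depends_on_def
proof (intro allI impI ball_cong refl)
  fix D D' g assume eq: "D \<inter> (\<Union>n<rk f. cell (blk f) n) = D' \<inter> (\<Union>n<rk f. cell (blk f) n)" and g: "g \<in> pred f"
  have "cell (blk g) (rk g) \<subseteq> (\<Union>n<rk f. cell (blk f) n)" using g by (auto simp: pred_def)
  then have "D \<inter> cell (blk g) (rk g) = D' \<inter> cell (blk g) (rk g)" using eq by blast
  then show "(\<not> act D g) = (\<not> act D' g)"
    using depends_onD[OF act_depends, of g D D'] g by (simp add: pred_def)
qed

text \<open>By exclusiveness, the probability that some fact of smaller rank in the block is output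
  is the sum of the probabilities of these facts, which are correct by induction.\<close>

lemma prob_out: "f \<in> facts \<Longrightarrow> measure_pmf.prob Q {D. f \<in> out D} = p f"
proof (induction "rk f" arbitrary: f rule: less_induct)
  case less
  let ?O = "map_pmf out Q"
  have fin: "finite_sets_pmf ?O" using finite_out by (auto simp: finite_sets_pmf_def)
  have O: "measure_pmf.prob ?O {D. R D} = measure_pmf.prob Q {D. R (out D)}" for R
    unfolding measure_map_pmf by (intro arg_cong[where f="measure_pmf.prob Q"]) auto
  have "((\<lambda>g. measure_pmf.prob ?O {D. g \<in> D}) has_sum measure_pmf.prob ?O {D. D \<inter> pred f \<noteq> {}}) (pred f)"
  proof (rule prob_meets_exclusive_has_sum[OF fin])
    fix x y D assume xy: "x \<in> pred f" "y \<in> pred f" "x \<noteq> y" "D \<in> set_pmf ?O" "x \<in> D" "y \<in> D"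
    then obtain E where "D = out E" by auto
    then show False using xy inj_onD[OF out_inj, of x y E] by (auto simp: pred_def)
  qed
  moreover have "measure_pmf.prob ?O {D. g \<in> D} = p g" if "g \<in> pred f" for g
    unfolding O using less.hyps[of g] that by (simp add: pred_def)
  ultimately have "(p has_sum measure_pmf.prob ?O {D. D \<inter> pred f \<noteq> {}}) (pred f)"
    by (simp cong: has_sum_cong)
  moreover have "(p has_sum measure_pmf.prob P {D. D \<inter> pred f \<noteq> {}}) (pred f)"
    by (rule exclusive_has_sum[of _ "blk f"]) (auto simp: pred_def)
  ultimately have eq: "measure_pmf.prob ?O {D. D \<inter> pred f \<noteq> {}} = measure_pmf.prob P {D. D \<inter> pred f \<noteq> {}}"
    using infsumI by metis
  have "measure_pmf.prob Q {D. f \<in> out D} = measure_pmf.prob Q {D. act D f \<and> (\<forall>g\<in>pred f. \<not> act D g)}"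
    using less.prems by (intro prob_pmf_cong) (auto simp: out_def)
  \<comment> \<open>Being active and having no active predecessor depend on cells of different
    ranks, which are disjoint.\<close>
  also have "\<dots> = measure_pmf.prob Q {D. act D f} * measure_pmf.prob Q {D. \<forall>g\<in>pred f. \<not> act D g}"
  proof (rule tuple_indep_conj[OF Q act_depends[OF less.prems] none_depends[OF less.prems]])
    have "cell (blk f) (rk f) \<inter> cell (blk f) n = {}" if "n < rk f" for n
      by (rule cell_disjoint) (use less.prems that in auto)
    then show "cell (blk f) (rk f) \<inter> (\<Union>n<rk f. cell (blk f) n) = {}" by blast
  qed
  also have "measure_pmf.prob Q {D. \<forall>g\<in>pred f. \<not> act D g} = measure_pmf.prob Q {D. True \<and> \<not> out D \<inter> pred f \<noteq> {}}"
    using ex_act_iff[OF less.prems] by (intro prob_pmf_cong) auto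
  also have "\<dots> = 1 - measure_pmf.prob ?O {D. D \<inter> pred f \<noteq> {}}"
    unfolding O by (subst prob_pmf_Diff) simp
  finally show ?case using prob_act[OF less.prems] unfolding eq by simp
qed

lemma out_depends:
  assumes f: "f \<in> facts"
  shows "depends_on (\<lambda>D. f \<in> out D) (\<Union>n. cell (blk f) n)"
  unfolding depends_on_def
proof (intro allI impI)
  fix D D' assume eq: "D \<inter> (\<Union>n. cell (blk f) n) = D' \<inter> (\<Union>n. cell (blk f) n)"
  have "D \<inter> cell (blk f) n = D' \<inter> cell (blk f) n" for n using eq by blast
  then have "act D g = act D' g" if "g \<in> facts" "blk g = blk f" for g
    using depends_onD[OF act_depends, of g D D'] that by simp
  then show "(f \<in> out D) = (f \<in> out D')"
    using f by (simp add: out_def pred_def)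
qed

text \<open>Facts of different blocks are selected through disjoint unions of cells, hence
  independently; with the marginals and exclusiveness this determines \<open>P\<close>.\<close>

lemma map_out_Q: "map_pmf out Q = P"
proof (rule block_indep_eqI[OF P, folded facts_eq])
  show "finite_sets_pmf (map_pmf out Q)" using finite_out by (auto simp: finite_sets_pmf_def)
  show "D \<subseteq> facts \<and> inj_on blk D" if "D \<in> set_pmf (map_pmf out Q)" for D
    using that out_subset out_inj by auto
  fix F assume F: "finite F" "F \<subseteq> facts" "inj_on blk F"
  have "measure_pmf.prob (map_pmf out Q) {D. F \<subseteq> D} = measure_pmf.prob Q {D. \<forall>f\<in>F. f \<in> out D}"
    unfolding measure_map_pmf by (intro arg_cong[where f="measure_pmf.prob Q"]) auto
  also have "\<dots> = (\<Prod>f\<in>F. measure_pmf.prob Q {D. f \<in> out D})"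
  proof (rule tuple_indep_ball[OF Q F(1)])
    show "depends_on (\<lambda>D. f \<in> out D) (\<Union>n. cell (blk f) n)" if "f \<in> F" for f
      by (rule out_depends) (use that F in blast)
    fix f g assume fg: "f \<in> F" "g \<in> F" "f \<noteq> g"
    then have "blk f \<noteq> blk g" using F(3) by (auto dest: inj_onD)
    moreover have "blk f \<in> blk ` facts" "blk g \<in> blk ` facts" using fg F(2) by blast+
    ultimately have "cell (blk f) n \<inter> cell (blk g) m = {}" for n m
      by (intro cell_disjoint) simp_all
    then show "(\<Union>n. cell (blk f) n) \<inter> (\<Union>n. cell (blk g) n) = {}" by blast
  qed
  also have "\<dots> = (\<Prod>f\<in>F. p f)" using F(2) by (intro prod.cong refl prob_out) blast
  finally show "measure_pmf.prob (map_pmf out Q) {D. F \<subseteq> D} = (\<Prod>f\<in>F. p f)" .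
qed

end

section \<open>First-order definability of the selection\<close>

text \<open>Closed, free of constants, and true over the empty domain as well, since the quantifier
  is universal.\<close>

definition truth :: "('r, 'u) fo" where
  "truth = All 0 (Eq (Var 0) (Var 0))"

definition conjs :: "('r, 'u) fo list \<Rightarrow> ('r, 'u) fo" where
  "conjs \<phi>s = foldr Conj \<phi>s truth"

definition disjs :: "('r, 'u) fo list \<Rightarrow> ('r, 'u) fo" where
  "disjs \<phi>s = foldr Disj \<phi>s (Neg truth)"

text \<open>The last variable is bound innermost, so in an induction the list of values grows at its
  end.\<close>

fun exs :: "nat \<Rightarrow> nat \<Rightarrow> ('r, 'u) fo \<Rightarrow> ('r, 'u) fo" where
  "exs k 0 \<phi> = \<phi>"
| "exs k (Suc m) \<phi> = exs k m (Ex (k + m) \<phi>)"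

definition vars :: "nat \<Rightarrow> nat \<Rightarrow> 'u fterm list" where
  "vars k m = map Var [k..<k + m]"

lemma sat_truth [simp]: "sat D A \<sigma> truth"
  by (simp add: truth_def)

lemma fo_fv_truth [simp]: "fo_fv truth = {}"
  by (simp add: truth_def)

lemma fo_wf_truth [simp]: "fo_wf S ar truth"
  by (simp add: truth_def)

lemma sat_conjs [simp]: "sat D A \<sigma> (conjs \<phi>s) \<longleftrightarrow> (\<forall>\<phi>\<in>set \<phi>s. sat D A \<sigma> \<phi>)"
  by (induction \<phi>s) (auto simp: conjs_def)

lemma fo_fv_conjs [simp]: "fo_fv (conjs \<phi>s) = (\<Union>\<phi>\<in>set \<phi>s. fo_fv \<phi>)"
  by (induction \<phi>s) (auto simp: conjs_def)

lemma fo_wf_conjs [simp]: "fo_wf S ar (conjs \<phi>s) \<longleftrightarrow> (\<forall>\<phi>\<in>set \<phi>s. fo_wf S ar \<phi>)"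
  by (induction \<phi>s) (auto simp: conjs_def)

lemma sat_disjs [simp]: "sat D A \<sigma> (disjs \<phi>s) \<longleftrightarrow> (\<exists>\<phi>\<in>set \<phi>s. sat D A \<sigma> \<phi>)"
  by (induction \<phi>s) (auto simp: disjs_def)

lemma fo_fv_disjs [simp]: "fo_fv (disjs \<phi>s) = (\<Union>\<phi>\<in>set \<phi>s. fo_fv \<phi>)"
  by (induction \<phi>s) (auto simp: disjs_def)

lemma fo_wf_disjs [simp]: "fo_wf S ar (disjs \<phi>s) \<longleftrightarrow> (\<forall>\<phi>\<in>set \<phi>s. fo_wf S ar \<phi>)"
  by (induction \<phi>s) (auto simp: disjs_def)

lemma fo_fv_exs [simp]: "fo_fv (exs k m \<phi>) = fo_fv \<phi> - {k..<k + m}"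
  by (induction m arbitrary: \<phi>) (auto simp: less_Suc_eq)

lemma fo_wf_exs [simp]: "fo_wf S ar (exs k m \<phi>) = fo_wf S ar \<phi>"
  by (induction m arbitrary: \<phi>) auto

definition override :: "nat \<Rightarrow> 'u list \<Rightarrow> (nat \<Rightarrow> 'u) \<Rightarrow> nat \<Rightarrow> 'u" where
  "override k ys \<sigma> i = (if k \<le> i \<and> i < k + length ys then ys ! (i - k) else \<sigma> i)"

lemma override_snoc: "(override k ys \<sigma>)(k + length ys := a) = override k (ys @ [a]) \<sigma>"
  by (auto simp: fun_eq_iff override_def nth_append)

lemma sat_exs:
  "sat D A \<sigma> (exs k m \<phi>) \<longleftrightarrow> (\<exists>ys. length ys = m \<and> set ys \<subseteq> A \<and> sat D A (override k ys \<sigma>) \<phi>)"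
proof (induction m arbitrary: \<phi>)
  case 0
  have "override k [] \<sigma> = \<sigma>" by (auto simp: fun_eq_iff override_def)
  then show ?case by simp
next
  case (Suc m)
  have "sat D A \<sigma> (exs k (Suc m) \<phi>) \<longleftrightarrow>
      (\<exists>ys. length ys = m \<and> set ys \<subseteq> A \<and> (\<exists>a\<in>A. sat D A (override k (ys @ [a]) \<sigma>) \<phi>))"
    by (auto simp: Suc.IH simp flip: override_snoc)
  also have "\<dots> \<longleftrightarrow> (\<exists>ys. length ys = Suc m \<and> set ys \<subseteq> A \<and> sat D A (override k ys \<sigma>) \<phi>)"
  proof
    assume "\<exists>ys. length ys = Suc m \<and> set ys \<subseteq> A \<and> sat D A (override k ys \<sigma>) \<phi>"
    then obtain ys where ys: "length ys = Suc m" "set ys \<subseteq> A" "sat D A (override k ys \<sigma>) \<phi>" by blast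
    then obtain zs a where "ys = zs @ [a]" by (metis length_Suc_conv_rev)
    with ys show "\<exists>ys. length ys = m \<and> set ys \<subseteq> A \<and> (\<exists>a\<in>A. sat D A (override k (ys @ [a]) \<sigma>) \<phi>)"
      by (intro exI[of _ zs]) auto
  next
    assume "\<exists>ys. length ys = m \<and> set ys \<subseteq> A \<and> (\<exists>a\<in>A. sat D A (override k (ys @ [a]) \<sigma>) \<phi>)"
    then obtain ys a where "length ys = m" "set ys \<subseteq> A" "a \<in> A" "sat D A (override k (ys @ [a]) \<sigma>) \<phi>" by blast
    then show "\<exists>ys. length ys = Suc m \<and> set ys \<subseteq> A \<and> sat D A (override k ys \<sigma>) \<phi>"
      by (intro exI[of _ "ys @ [a]"]) auto
  qed
  finally show ?case .
qed

lemma length_vars [simp]: "length (vars k m) = m"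
  by (simp add: vars_def)

lemma tvars_vars [simp]: "(\<Union>t\<in>set (vars k m). tvars t) = {k..<k + m}"
  by (auto simp: vars_def)

lemma map_tval_vars: "length ys = m \<Longrightarrow> map (tval (override k ys \<sigma>)) (vars k m) = ys"
  by (rule nth_equalityI) (auto simp: vars_def override_def)

lemma tval_override: "tvars t \<subseteq> {..<k} \<Longrightarrow> tval (override k ys \<sigma>) t = tval \<sigma> t"
  by (cases t) (auto simp: override_def)

lemma map_tval_override:
  "(\<Union>t\<in>set ts. tvars t) \<subseteq> {..<k} \<Longrightarrow> map (tval (override k ys \<sigma>)) ts = map (tval \<sigma>) ts"
  by (intro map_cong refl tval_override) auto

section \<open>Formulas about one cell identifier\<close>

definition eqs :: "'u fterm list \<Rightarrow> 'u fterm list \<Rightarrow> ('r, 'u) fo" where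
  "eqs us ts = conjs (map2 Eq us ts)"

lemma sat_eqs:
  assumes "length us = length ts"
  shows "sat D A \<sigma> (eqs us ts) \<longleftrightarrow> map (tval \<sigma>) us = map (tval \<sigma>) ts"
  using assms by (auto simp: eqs_def list_eq_iff_nth_eq set_zip)

lemma fo_fv_eqs:
  assumes "length us = length ts"
  shows "fo_fv (eqs us ts) = (\<Union>t\<in>set us. tvars t) \<union> (\<Union>t\<in>set ts. tvars t)"
  using assms unfolding eqs_def by (induction us ts rule: list_induct2) auto

lemma fo_wf_eqs [simp]: "fo_wf S ar (eqs us ts)"
  by (auto simp: eqs_def set_zip)

text \<open>Activity as far as a formula can see it: \<open>c\<close> stands for the cell, and
  neither blocks nor \<open>facts\<close> are mentioned. On the support of the constructed law, with
  \<open>c\<close> the identifier of \<open>f\<close>, it amounts to \<open>act\<close> for the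
  facts of \<open>P\<close>.\<close>

definition sole_fact :: "'r \<Rightarrow> 'r set \<Rightarrow> ('r \<Rightarrow> nat) \<Rightarrow> ('r, 'u) inst \<Rightarrow> 'u \<Rightarrow> ('r, 'u) fact \<Rightarrow> bool" where
  "sole_fact Z S ar D c f \<longleftrightarrow> (fst f, c # snd f) \<in> D \<and> (Z, [c]) \<notin> D \<and>
     (\<forall>g. fact_over S ar g \<and> (fst g, c # snd g) \<in> D \<longrightarrow> g = f)"

text \<open>In \<open>sole_fm Z Ss ar R t ts m\<close>, the variables from \<open>m\<close> on are fresh, i.e. they do not
  occur in \<open>t\<close> and \<open>ts\<close>.\<close>

definition sole_fm :: "'r \<Rightarrow> 'r list \<Rightarrow> ('r \<Rightarrow> nat) \<Rightarrow> 'r \<Rightarrow> 'u fterm \<Rightarrow> 'u fterm list \<Rightarrow> nat \<Rightarrow> ('r, 'u) fo" where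
  "sole_fm Z Ss ar R t ts m = Conj (Atom R (t # ts)) (Conj (Neg (Atom Z [t]))
     (conjs (map (\<lambda>R'. Neg (exs m (ar R') (Conj (Atom R' (t # vars m (ar R')))
        (if R' = R then Neg (eqs (vars m (ar R')) ts) else truth)))) Ss)))"

lemma adom_Cons: "(R, c # as) \<in> D \<Longrightarrow> c \<in> adom D \<and> set as \<subseteq> adom D"
  unfolding adom_def by force

lemma sat_sole_fm:
  assumes A: "adom D \<subseteq> A" and t: "tvars t \<subseteq> {..<m}" "(\<Union>t\<in>set ts. tvars t) \<subseteq> {..<m}"
    and ts: "length ts = ar R"
  shows "sat D A \<sigma> (sole_fm Z Ss ar R t ts m) \<longleftrightarrow>
    sole_fact Z (set Ss) ar D (tval \<sigma> t) (R, map (tval \<sigma>) ts)"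
proof -
  let ?c = "tval \<sigma> t" and ?as = "map (tval \<sigma>) ts"
  have eqs: "sat D A (override m ys \<sigma>) (eqs (vars m (ar R)) ts) \<longleftrightarrow> ys = ?as"
    if "length ys = ar R" for ys
    by (subst sat_eqs) (simp_all add: ts map_tval_vars[OF that] map_tval_override[OF t(2)])
  have "sat D A \<sigma> (exs m (ar R') (Conj (Atom R' (t # vars m (ar R')))
        (if R' = R then Neg (eqs (vars m (ar R')) ts) else truth))) \<longleftrightarrow>
      (\<exists>ys. length ys = ar R' \<and> (R', ?c # ys) \<in> D \<and> \<not> (R' = R \<and> ys = ?as))" for R'
  proof -
    have body: "sat D A (override m ys \<sigma>) (Conj (Atom R' (t # vars m (ar R')))
        (if R' = R then Neg (eqs (vars m (ar R')) ts) else truth)) \<longleftrightarrow>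
      (R', ?c # ys) \<in> D \<and> \<not> (R' = R \<and> ys = ?as)" if "length ys = ar R'" for ys
      using that eqs by (simp add: map_tval_vars[OF that] tval_override[OF t(1)])
    \<comment> \<open>A witness occurs in \<open>D\<close>, so restricting the quantifiers to
      \<open>A\<close> loses nothing.\<close>
    have "set ys \<subseteq> A" if "(R', ?c # ys) \<in> D" for ys
      using A adom_Cons[OF that] by blast
    then show ?thesis unfolding sat_exs using body by metis
  qed
  then show ?thesis
    by (auto simp: sole_fm_def sole_fact_def fact_over_def)
qed

lemma fo_fv_sole_fm:
  assumes "length ts = ar R"
  shows "fo_fv (sole_fm Z Ss ar R t ts m) \<subseteq> tvars t \<union> (\<Union>t\<in>set ts. tvars t)"
  using assms by (auto simp: sole_fm_def fo_fv_eqs split: if_splits)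

lemma fo_wf_sole_fm:
  assumes "length ts = ar R" "set Ss \<subseteq> S'" "R \<in> S'" "Z \<in> S'" "ar' Z = 1"
    and "\<And>R. R \<in> set Ss \<Longrightarrow> ar' R = Suc (ar R)" "R \<in> set Ss"
  shows "fo_wf S' ar' (sole_fm Z Ss ar R t ts m)"
  using assms by (auto simp: sole_fm_def)

definition ex_sole_fm :: "'r \<Rightarrow> 'r list \<Rightarrow> ('r \<Rightarrow> nat) \<Rightarrow> 'u \<Rightarrow> nat \<Rightarrow> ('r, 'u) fo" where
  "ex_sole_fm Z Ss ar c m = disjs (map (\<lambda>R. exs m (ar R)
     (sole_fm Z Ss ar R (Const c) (vars m (ar R)) (m + ar R))) Ss)"

lemma sat_ex_sole_fm:
  assumes A: "adom D \<subseteq> A"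
  shows "sat D A \<sigma> (ex_sole_fm Z Ss ar c m) \<longleftrightarrow> (\<exists>f. fact_over (set Ss) ar f \<and> sole_fact Z (set Ss) ar D c f)"
proof -
  have sat: "sat D A (override m ys \<sigma>) (sole_fm Z Ss ar R (Const c) (vars m (ar R)) (m + ar R)) \<longleftrightarrow>
      sole_fact Z (set Ss) ar D c (R, ys)" if "length ys = ar R" for R ys
    by (subst sat_sole_fm[OF A]) (auto simp: map_tval_vars[OF that])
  have A': "set ys \<subseteq> A" if "sole_fact Z (set Ss) ar D c (R, ys)" for R ys
    using that A adom_Cons[of R c ys D] by (auto simp: sole_fact_def)
  have "sat D A \<sigma> (ex_sole_fm Z Ss ar c m) \<longleftrightarrow>
      (\<exists>R\<in>set Ss. \<exists>ys. length ys = ar R \<and> set ys \<subseteq> A \<and> sole_fact Z (set Ss) ar D c (R, ys))"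
    by (simp add: ex_sole_fm_def sat_exs sat cong: conj_cong)
  also have "\<dots> \<longleftrightarrow> (\<exists>f. fact_over (set Ss) ar f \<and> sole_fact Z (set Ss) ar D c f)"
    using A' by (fastforce simp: fact_over_def)
  finally show ?thesis .
qed

lemma fo_fv_ex_sole_fm [simp]: "fo_fv (ex_sole_fm Z Ss ar c m) = {}"
  using fo_fv_sole_fm[of "vars m (ar R)" ar R Z Ss "Const c" "m + ar R" for R]
  by (fastforce simp: ex_sole_fm_def)

text \<open>\<open>Es\<close> lists the pairs of identifiers of which the first precedes the second;
  being finite, it can be written into the formula with constants. Variable \<open>ar R\<close>, the
  first after the output columns, holds the identifier of the candidate.\<close>

definition select_fm :: "'r \<Rightarrow> 'r list \<Rightarrow> ('r \<Rightarrow> nat) \<Rightarrow> ('u \<times> 'u) list \<Rightarrow> 'r \<Rightarrow> ('r, 'u) fo" where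
  "select_fm Z Ss ar Es R = Ex (ar R) (Conj (sole_fm Z Ss ar R (Var (ar R)) (vars 0 (ar R)) (Suc (ar R)))
     (conjs (map (\<lambda>x. Disj (Neg (Eq (Var (ar R)) (Const (snd x)))) (Neg (ex_sole_fm Z Ss ar (fst x) (Suc (ar R))))) Es)))"

lemma sat_select_fm:
  assumes A: "adom D \<subseteq> A" and as: "length as = ar R"
  shows "sat D A (\<lambda>i. as ! i) (select_fm Z Ss ar Es R) \<longleftrightarrow>
    (\<exists>d. sole_fact Z (set Ss) ar D d (R, as) \<and>
      (\<forall>c. (c, d) \<in> set Es \<longrightarrow> \<not> (\<exists>f. fact_over (set Ss) ar f \<and> sole_fact Z (set Ss) ar D c f)))"
proof -
  have vars: "map (tval ((\<lambda>i. as ! i)(ar R := d))) (vars 0 (ar R)) = as" for d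
    by (rule nth_equalityI) (auto simp: vars_def as)
  have sole: "sat D A ((\<lambda>i. as ! i)(ar R := d)) (sole_fm Z Ss ar R (Var (ar R)) (vars 0 (ar R)) (Suc (ar R)))
      \<longleftrightarrow> sole_fact Z (set Ss) ar D d (R, as)" for d
    by (subst sat_sole_fm[OF A]) (auto simp: vars)
  have d: "d \<in> A" if "sole_fact Z (set Ss) ar D d (R, as)" for d
    using that A adom_Cons[of R d as D] by (auto simp: sole_fact_def)
  show ?thesis
    unfolding select_fm_def using d by (simp add: sole sat_ex_sole_fm[OF A]) fastforce
qed

lemma fo_fv_select_fm: "fo_fv (select_fm Z Ss ar Es R) \<subseteq> {..<ar R}"
  using fo_fv_sole_fm[of "vars 0 (ar R)" ar R Z Ss "Var (ar R)" "Suc (ar R)"]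
  by (auto simp: select_fm_def split: prod.splits)

lemma fo_wf_select_fm:
  assumes "set Ss \<subseteq> S'" "R \<in> set Ss" "Z \<in> S'" "ar' Z = 1"
    and "\<And>R. R \<in> set Ss \<Longrightarrow> ar' R = Suc (ar R)"
  shows "fo_wf S' ar' (select_fm Z Ss ar Es R)"
  using assms by (auto simp: select_fm_def ex_sole_fm_def intro!: fo_wf_sole_fm)

text \<open>Constants may widen the range of output tuples beyond \<open>adom D\<close>, but a sole
  fact is stored in \<open>D\<close>, so its arguments already lie in \<open>adom D\<close>.\<close>

lemma apply_view_select_fm:
  "apply_view (set Ss) ar (select_fm Z Ss ar Es) D =
    {f. fact_over (set Ss) ar f \<and> (\<exists>d. sole_fact Z (set Ss) ar D d f \<and>
      (\<forall>c. (c, d) \<in> set Es \<longrightarrow> \<not> (\<exists>g. fact_over (set Ss) ar g \<and> sole_fact Z (set Ss) ar D c g)))}"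
proof -
  have "set as \<subseteq> adom D" if "sole_fact Z (set Ss) ar D d (R, as)" for R as d
    using that adom_Cons[of R d as D] by (auto simp: sole_fact_def)
  then show ?thesis
    unfolding apply_view_def fact_over_def[of _ _ "(_, _)"]
    by (auto simp: sat_select_fm fact_over_def[of "set Ss" ar "(_, _)"])
qed

section \<open>From block-independent databases to the selecting view\<close>

lemma is_BID_block_indep:
  assumes "is_BID S ar P"
  obtains blk :: "('r, 'u) fact \<Rightarrow> ('r, 'u) fact set" where "block_indep P blk"
proof -
  have pdb: "pdb S ar P" using assms unfolding is_BID_def by (rule conjunct1)
  from assms obtain B where part: "partition_on (pdb_facts P) B"
    and ind: "\<forall>F. finite F \<and> F \<subseteq> pdb_facts P \<and>
        (\<forall>f\<in>F. \<forall>g\<in>F. f \<noteq> g \<longrightarrow> \<not> (\<exists>b\<in>B. f \<in> b \<and> g \<in> b)) \<longrightarrow>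
        measure_pmf.prob P {D. F \<subseteq> D} = (\<Prod>f\<in>F. measure_pmf.prob P {D. f \<in> D})"
    and ex: "\<forall>b\<in>B. \<forall>f\<in>b. \<forall>g\<in>b. f \<noteq> g \<longrightarrow> measure_pmf.prob P {D. f \<in> D \<and> g \<in> D} = 0"
    unfolding is_BID_def by (elim conjE exE) (rule that)
  \<comment> \<open>A fact is labelled by its block, which is unique as the blocks are
    disjoint.\<close>
  define blk where "blk f = (THE b. b \<in> B \<and> f \<in> b)" for f
  have blk_eq: "blk f = b" if "b \<in> B" "f \<in> b" for f b
    unfolding blk_def using that partition_onD2[OF part]
    by (intro the_equality) (auto simp: disjoint_def)
  have blk: "blk f \<in> B \<and> f \<in> blk f" if f: "f \<in> pdb_facts P" for f
  proof -
    obtain b where "b \<in> B" "f \<in> b" using f partition_onD1[OF part] by blast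
    then show ?thesis using blk_eq by metis
  qed
  have "block_indep P blk"
    unfolding block_indep_def
  proof (intro conjI allI impI ballI)
    show "finite_sets_pmf P" using pdb by (auto simp: pdb_def inst_over_def finite_sets_pmf_def)
  next
    fix F assume F: "finite F \<and> F \<subseteq> \<Union> (set_pmf P) \<and> inj_on blk F"
    have sep: "\<not> (\<exists>b\<in>B. f \<in> b \<and> g \<in> b)" if fg: "f \<in> F" "g \<in> F" "f \<noteq> g" for f g
    proof
      assume "\<exists>b\<in>B. f \<in> b \<and> g \<in> b"
      then have "blk f = blk g" using blk_eq by metis
      then show False using fg F by (auto dest: inj_onD)
    qed
    have "finite F \<and> F \<subseteq> pdb_facts P \<and>
        (\<forall>f\<in>F. \<forall>g\<in>F. f \<noteq> g \<longrightarrow> \<not> (\<exists>b\<in>B. f \<in> b \<and> g \<in> b))"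
    proof (intro conjI ballI impI)
      show "finite F" using F by (rule conjunct1)
      show "F \<subseteq> pdb_facts P" using F unfolding pdb_facts_def by (elim conjE)
    qed (rule sep)
    then show "measure_pmf.prob P {D. F \<subseteq> D} = (\<Prod>f\<in>F. measure_pmf.prob P {D. f \<in> D})"
      by (rule ind[THEN spec, THEN mp])
  next
    fix D assume D: "D \<in> set_pmf P"
    show "inj_on blk D"
    proof (rule inj_onI, rule ccontr)
      fix f g assume fg: "f \<in> D" "g \<in> D" "blk f = blk g" "f \<noteq> g"
      have "f \<in> pdb_facts P" "g \<in> pdb_facts P" using fg D by (auto simp: pdb_facts_def)
      then have "blk f \<in> B" "f \<in> blk f" "g \<in> blk f" using blk fg(3) by metis+
      then have "measure_pmf.prob P {D. f \<in> D \<and> g \<in> D} = 0" using ex fg(4) by blast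
      then show False using D fg by (auto simp: measure_pmf_zero_iff)
    qed
  qed
  then show ?thesis by (rule that)
qed

lemma countable_inj_on_infinite:
  assumes "countable A" "infinite (UNIV :: 'b set)"
  obtains \<iota> :: "'a \<Rightarrow> 'b" where "inj_on \<iota> A"
proof -
  obtain f :: "nat \<Rightarrow> 'b" where "inj f" using infinite_countable_subset[OF assms(2)] by blast
  then have "inj_on (f \<circ> to_nat_on A) A"
    using assms(1) by (intro comp_inj_on inj_on_to_nat_on) (auto intro: inj_on_subset)
  then show ?thesis by (rule that)
qed

theorem theorem5p9:
  fixes S :: "'r set" and ar :: "'r \<Rightarrow> nat" and P :: "('r, 'u::countable) inst pmf"
  assumes "infinite (UNIV :: 'u set)"
    and "infinite (UNIV :: 'r set)"
    and "is_BID S ar P"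
  shows "in_FO_TI S ar P"
proof -
  define facts where "facts = \<Union> (set_pmf P)"
  have pdb: "pdb S ar P" using assms(3) unfolding is_BID_def by (rule conjunct1)
  have schema: "schema S" "finite S" using pdb by (auto simp: pdb_def schema_def)
  have facts_over: "fact_over S ar f" if "f \<in> facts" for f
    using that pdb by (auto simp: facts_def pdb_def inst_over_def)
  obtain blk :: "('r, 'u) fact \<Rightarrow> ('r, 'u) fact set" where bi: "block_indep P blk"
    using is_BID_block_indep[OF assms(3)] .
  have countable_facts: "countable facts"
    using bi by (simp add: facts_def block_indep_def finite_sets_pmf_countable)
  obtain H where H: "finite H" "H \<subseteq> facts"
    "infsum (\<lambda>f. measure_pmf.prob P {D. f \<in> D}) (facts - H) \<le> 1 / 4"
    using summable_on_small_tail[OF block_indep_summable[OF bi], of "1 / 4"] unfolding facts_def by auto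
  \<comment> \<open>Heads are numbered from 1, since rank 0 is reserved for the tail.\<close>
  define rk where "rk f = (if f \<in> H then Suc (to_nat_on H f) else 0)" for f
  \<comment> \<open>Cells are named by elements of the universe, so that identifiers can be stored
    as arguments of facts.\<close>
  have "countable (blk ` facts \<times> (UNIV :: nat set))" using countable_facts by simp
  then obtain \<iota> :: "('r, 'u) fact set \<times> nat \<Rightarrow> 'u" where inj_\<iota>: "inj_on \<iota> (blk ` facts \<times> UNIV)"
    using assms(1) by (rule countable_inj_on_infinite)
  \<comment> \<open>A fresh symbol for the blockers keeps \<open>z\<close> apart from
    \<open>e\<close>.\<close>
  obtain Z where Z: "Z \<notin> S" using ex_new_if_finite[OF assms(2) schema(2)] by blast
  define idf where "idf f = \<iota> (blk f, rk f)" for f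
  define e where "e f = (fst f, idf f # snd f)" for f
  define z where "z b n = (Z, [\<iota> (b, n)])" for b n
  have idf_eq: "idf f = idf g \<longleftrightarrow> blk f = blk g \<and> rk f = rk g" if "f \<in> facts" "g \<in> facts" for f g
    unfolding idf_def using that inj_on_eq_iff[OF inj_\<iota>, of "(blk f, rk f)" "(blk g, rk g)"] by simp
  interpret block_selection P facts blk rk e z
  proof
    show "block_indep P blk" by (rule bi)
    show "facts = \<Union> (set_pmf P)" by (rule facts_def)
    show "inj_on e facts" by (auto simp: inj_on_def e_def prod_eq_iff)
    show "inj_on (case_prod z) (blk ` facts \<times> UNIV)"
    proof (rule inj_onI)
      fix x y assume xy: "x \<in> blk ` facts \<times> UNIV" "y \<in> blk ` facts \<times> UNIV" "case_prod z x = case_prod z y"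
      then have "\<iota> x = \<iota> y" by (simp add: z_def case_prod_unfold)
      then show "x = y" using inj_onD[OF inj_\<iota>] xy by blast
    qed
    show "e f \<noteq> z (blk g) n" if "f \<in> facts" for f g n
      using facts_over[OF that] Z by (auto simp: e_def z_def fact_over_def)
    have heads: "{f\<in>facts. rk f \<noteq> 0} = H" "{f\<in>facts. rk f = 0} = facts - H"
      using H by (auto simp: rk_def)
    show "finite {f\<in>facts. rk f \<noteq> 0}" unfolding heads by (rule H)
    show "infsum (\<lambda>f. measure_pmf.prob P {D. f \<in> D}) {f\<in>facts. rk f = 0} \<le> 1 / 4"
      unfolding heads by (rule H)
    show "f = g" if "rk f = rk g" "rk f \<noteq> 0" for f g
    proof (rule inj_onD[OF inj_on_to_nat_on[OF countable_finite[OF H(1)]]])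
      show H: "f \<in> H" "g \<in> H" using that by (simp_all add: rk_def split: if_splits)
      show "to_nat_on H f = to_nat_on H g" using that(1) H by (simp add: rk_def)
    qed
  qed
  define S' where "S' = insert Z S"
  define ar' where "ar' R = (if R = Z then 1 else Suc (ar R))" for R
  have TI: "is_TI S' ar' Q"
    unfolding is_TI_def
  proof (intro conjI allI impI)
    have "fact_over S' ar' f" if f: "f \<in> support" for f
    proof -
      consider g where "g \<in> facts" "f = e g" | b where "f = z b 0"
        using f unfolding support_def by blast
      then show ?thesis
      proof cases
        case 1
        then show ?thesis using facts_over[OF 1(1)] Z by (auto simp: e_def S'_def ar'_def fact_over_def)
      qed (simp add: z_def S'_def ar'_def fact_over_def)
    qed
    then have "inst_over S' ar' D" if "D \<in> set_pmf Q" for D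
      using that Q Q_support[OF that] by (auto simp: inst_over_def tuple_indep_def finite_sets_pmf_def)
    then show "pdb S' ar' Q" using schema by (auto simp: pdb_def schema_def S'_def)
    fix F :: "('r, 'u) inst" assume "finite F"
    then show "measure_pmf.prob Q {D. F \<subseteq> D} = (\<Prod>f\<in>F. measure_pmf.prob Q {D. f \<in> D})"
      using Q by (simp add: tuple_indep_marginal[OF Q]) (simp add: tuple_indep_def)
  qed
  obtain Ss where Ss: "set Ss = S" using finite_list[OF schema(2)] by blast
  define E where "E = (\<Union>f\<in>facts. (\<lambda>g. (idf g, idf f)) ` pred f)"
  \<comment> \<open>Only a head \<open>f\<close> has predecessors, and an infinite tail contributes
    a single identifier, so at most \<open>rk f\<close> identifiers precede that of
    \<open>f\<close>.\<close>
  have "finite E"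
  proof (rule finite_subset)
    show "E \<subseteq> (\<Union>f\<in>H. (\<lambda>n. (\<iota> (blk f, n), idf f)) ` {..<rk f})"
      unfolding E_def by (auto simp: pred_def idf_def rk_def split: if_splits)
    show "finite (\<Union>f\<in>H. (\<lambda>n. (\<iota> (blk f, n), idf f)) ` {..<rk f})" using H by simp
  qed
  then obtain Es where Es: "set Es = E" using finite_list by blast
  define V where "V = select_fm Z Ss ar Es"
  have view: "fo_view S' ar' S ar V"
    unfolding fo_view_def
  proof (intro conjI ballI)
    show "schema S'" "schema S" using schema by (auto simp: schema_def S'_def)
    fix R assume R: "R \<in> S"
    show "fo_fv (V R) \<subseteq> {..<ar R}" unfolding V_def by (rule fo_fv_select_fm)
    show "fo_wf S' ar' (V R)"
      unfolding V_def by (rule fo_wf_select_fm) (use R Ss Z in \<open>auto simp: S'_def ar'_def\<close>)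
  qed
  have sole: "fact_over S ar f \<and> sole_fact Z S ar D c f \<longleftrightarrow> f \<in> facts \<and> c = idf f \<and> act D f"
    if D: "D \<in> set_pmf Q" for D c f
  proof -
    \<comment> \<open>On the support, a fact over \<open>S\<close> extended by an identifier encodes
      a fact of \<open>P\<close>: blockers are ruled out because \<open>Z\<close> is not in
      \<open>S\<close>.\<close>
    have mem: "fact_over S ar g \<and> (fst g, c # snd g) \<in> D \<longleftrightarrow> g \<in> facts \<and> c = idf g \<and> e g \<in> D" for g c
    proof
      assume *: "fact_over S ar g \<and> (fst g, c # snd g) \<in> D"
      then have "(fst g, c # snd g) \<in> support" using Q_support[OF D] by blast
      moreover have "(fst g, c # snd g) \<noteq> z b 0" for b
        using * Z by (auto simp: z_def fact_over_def)
      ultimately obtain h where h: "h \<in> facts" "(fst g, c # snd g) = e h" unfolding support_def by blast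
      then have "h = g" by (simp add: e_def prod_eq_iff)
      with h * show "g \<in> facts \<and> c = idf g \<and> e g \<in> D" by (simp add: e_def)
    qed (use facts_over in \<open>auto simp: e_def\<close>)
    have zc: "z (blk f) (rk f) = (Z, [idf f])" by (simp add: z_def idf_def)
    have "fact_over S ar f \<and> sole_fact Z S ar D c f \<longleftrightarrow> f \<in> facts \<and> c = idf f \<and> e f \<in> D \<and>
        (Z, [c]) \<notin> D \<and> (\<forall>g. g \<in> facts \<and> c = idf g \<and> e g \<in> D \<longrightarrow> g = f)"
      unfolding sole_fact_def using mem by blast
    also have "\<dots> \<longleftrightarrow> f \<in> facts \<and> c = idf f \<and> act D f"
      unfolding act_def zc using idf_eq by metis
    finally show ?thesis .
  qed
  have "apply_view S ar V D = out D" if D: "D \<in> set_pmf Q" for D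
  proof -
    have none: "(\<forall>c. (c, idf f) \<in> E \<longrightarrow> \<not> (\<exists>g. g \<in> facts \<and> c = idf g \<and> act D g)) \<longleftrightarrow> (\<forall>g\<in>pred f. \<not> act D g)"
      if f: "f \<in> facts" for f
    proof -
      \<comment> \<open>The pair may stem from other facts \<open>g'\<close>, \<open>f'\<close> of
        the same cells, but \<open>pred\<close> depends only on block and rank.\<close>
      have "(idf g, idf f) \<in> E \<longleftrightarrow> g \<in> pred f" if g: "g \<in> facts" for g
      proof
        assume "(idf g, idf f) \<in> E"
        then obtain f' g' where f': "f' \<in> facts" "g' \<in> pred f'" "idf g = idf g'" "idf f = idf f'"
          unfolding E_def by auto
        then show "g \<in> pred f" using idf_eq[OF f f'(1)] idf_eq[OF g, of g'] g by (simp add: pred_def)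
      qed (use f in \<open>auto simp: E_def\<close>)
      moreover have "pred f \<subseteq> facts" by (auto simp: pred_def)
      ultimately show ?thesis by blast
    qed
    have "apply_view S ar V D = {f. \<exists>d. (fact_over S ar f \<and> sole_fact Z S ar D d f) \<and>
      (\<forall>c. (c, d) \<in> E \<longrightarrow> \<not> (\<exists>g. fact_over S ar g \<and> sole_fact Z S ar D c g))}"
      unfolding V_def using apply_view_select_fm[of Ss ar Z Es D] unfolding Ss Es by blast
    also have "\<dots> = {f\<in>facts. act D f \<and>
      (\<forall>c. (c, idf f) \<in> E \<longrightarrow> \<not> (\<exists>g. g \<in> facts \<and> c = idf g \<and> act D g))}"
      unfolding sole[OF D] by blast
    also have "\<dots> = out D" unfolding out_def using none by blast
    finally show ?thesis .
  qed
  then have "map_pmf (apply_view S ar V) Q = map_pmf out Q" by (intro map_pmf_cong) auto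
  then have "map_pmf (apply_view S ar V) Q = P" using map_out_Q by simp
  with TI view show ?thesis unfolding in_FO_TI_def by blast
qed

end
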